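(* $H_1(\widehat{\Gamma}_{X_7};\mathbb{Z})\cong\mathbb{Z}/5\times\mathbb{Z}/2$, and the generators are the images of $\psi_1$ and $\sigma_{13}$.
   Context: For a group $G$, $H_1(G;\mathbb{Z})=G/[G,G]$ is the abelianization. Matrices and mutations. Let $I$ be a finite set (no frozen vertices here) and $\varepsilon=(\varepsilon_{ij})_{i,j\in I}$ an integer skew-symmetric matrix (exchange matrix), identified with the quiver with vertex set $I$ and $\varepsilon_{ij}$ arrows $i\to j$ whenever $\varepsilon_{ij}>0$. For $k\in I$, the mutation $\mu_k(\varepsilon)=\varepsilon'$ is $\varepsilon'_{ij}=-\varepsilon_{ij}$ if $k\in\{i,j\}$, and $\varepsilon'_{ij}=\varepsilon_{ij}+\frac12(|\varepsilon_{ik}|\varepsilon_{kj}+\varepsilon_{ik}|\varepsilon_{kj}|)$ otherwise. A permutation $\sigma$ of $I$ acts by $\sigma(\varepsilon)_{ij}=\varepsilon_{\sigma^{-1}(i),\sigma^{-1}(j)}$. A mutation sequence is a finite composition of mutations and permutations, applied from right to left; it is a mutation loop at $\varepsilon$ if it sends $\varepsilon$ to $\varepsilon$. Saturated cluster modular group. $\widehat{\Gamma}_\varepsilon$ is the group (under composition) of mutation loops with initial exchange matrix $\varepsilon$, modulo the equivalence relation generated by: (1) $\mu_k\mu_k=1$; (2) $\sigma\mu_k\sigma^{-1}=\mu_{\sigma(k)}$ for permutations $\sigma$; (3) the standard relations, applicable at any stage of a sequence to the current matrix $\varepsilon'$: $\mu_i\mu_j=\mu_j\mu_i$ if $\varepsilon'_{ij}=0$,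 and $\mu_i\mu_j\mu_i\mu_j\mu_i=(i\ j)$ if $\varepsilon'_{ij}=\pm1$. Permutations compose as usual (right to left). Type $X_7$. $I=\{0,1,\dots,6\}$, and the quiver $X_7$ has, for each $k\in\{1,3,5\}$, one arrow $0\to k$, two arrows $k\to k+1$, one arrow $k+1\to 0$, and no other arrows. $\widehat{\Gamma}_{X_7}$ is the saturated cluster modular group based at this quiver. The elements are $\psi_1=(0\ 1\ 2)(3\ 4\ 5\ 6)\mu_2\mu_1\mu_0$ (cycles $a\mapsto b\mapsto\cdots$) and the permutation $\sigma_{13}=(1\ 3)(2\ 4)$. *)

theory Defs
  imports
    "HOL-Combinatorics.Cycles"
    "HOL-Algebra.Generated_Groups"
    "HOL-Algebra.Elementary_Groups"
begin

section \<open>Exchange matrices, mutations and permutations\<close>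

text \<open>
  A matrix indexed by a finite set \<open>I\<close> is a function on the whole index type that vanishes off
  \<open>I \<times> I\<close>. Mutation at an element of \<open>I\<close> and permutations of \<open>I\<close> preserve this property, so
  that equality of functions is equality of matrices.
\<close>

type_synonym 'i matrix = "'i \<Rightarrow> 'i \<Rightarrow> int"

definition exchange_matrix :: "'i set \<Rightarrow> 'i matrix \<Rightarrow> bool" where
  "exchange_matrix I \<epsilon> \<longleftrightarrow> finite I \<and> (\<forall>i j. \<epsilon> i j = - \<epsilon> j i)
     \<and> (\<forall>i j. i \<notin> I \<or> j \<notin> I \<longrightarrow> \<epsilon> i j = 0)"

text \<open>The division by 2 is exact: \<open>\<bar>a\<bar> * b + a * \<bar>b\<bar>\<close> is \<open>0\<close> or \<open>\<plusminus> 2 * a * b\<close>.\<close>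

definition mutate :: "'i \<Rightarrow> 'i matrix \<Rightarrow> 'i matrix" where
  "mutate k \<epsilon> = (\<lambda>i j. if i = k \<or> j = k then - \<epsilon> i j
     else \<epsilon> i j + (\<bar>\<epsilon> i k\<bar> * \<epsilon> k j + \<epsilon> i k * \<bar>\<epsilon> k j\<bar>) div 2)"

definition permute_matrix :: "('i \<Rightarrow> 'i) \<Rightarrow> 'i matrix \<Rightarrow> 'i matrix" where
  "permute_matrix \<sigma> \<epsilon> = (\<lambda>i j. \<epsilon> (inv_into UNIV \<sigma> i) (inv_into UNIV \<sigma> j))"

section \<open>Mutation sequences and mutation loops\<close>

datatype 'i letter = Mut 'i | Perm "'i \<Rightarrow> 'i"

text \<open>Written from left to right as in the literature, hence applied starting from the last letter.\<close>

type_synonym 'i mutation_sequence = "'i letter list"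

definition mutation_sequences :: "'i set \<Rightarrow> 'i mutation_sequence set" where
  "mutation_sequences I = lists (Mut ` I \<union> Perm ` {\<sigma>. \<sigma> permutes I})"

fun apply_letter :: "'i letter \<Rightarrow> 'i matrix \<Rightarrow> 'i matrix" where
  "apply_letter (Mut k) \<epsilon> = mutate k \<epsilon>"
| "apply_letter (Perm \<sigma>) \<epsilon> = permute_matrix \<sigma> \<epsilon>"

definition apply_sequence :: "'i mutation_sequence \<Rightarrow> 'i matrix \<Rightarrow> 'i matrix" where
  "apply_sequence w \<epsilon> = foldr apply_letter w \<epsilon>"

definition mutation_loops :: "'i set \<Rightarrow> 'i matrix \<Rightarrow> 'i mutation_sequence set" where
  "mutation_loops I \<epsilon> = {w \<in> mutation_sequences I. apply_sequence w \<epsilon> = \<epsilon>}"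

section \<open>The saturated cluster modular group\<close>

text \<open>
  The relations available when the current matrix is \<open>\<epsilon>\<close>. The last two rules identify a
  composite of permutations with the permutation it represents.
\<close>

inductive basic_relation ::
    "'i set \<Rightarrow> 'i matrix \<Rightarrow> 'i mutation_sequence \<Rightarrow> 'i mutation_sequence \<Rightarrow> bool"
  for I :: "'i set" and \<epsilon> :: "'i matrix" where
  involution: "k \<in> I \<Longrightarrow> basic_relation I \<epsilon> [Mut k, Mut k] []"
| conjugation: "\<sigma> permutes I \<Longrightarrow> k \<in> I \<Longrightarrow>
    basic_relation I \<epsilon> [Perm \<sigma>, Mut k, Perm (inv_into UNIV \<sigma>)] [Mut (\<sigma> k)]"
| square: "i \<in> I \<Longrightarrow> j \<in> I \<Longrightarrow> \<epsilon> i j = 0 \<Longrightarrow>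
    basic_relation I \<epsilon> [Mut i, Mut j] [Mut j, Mut i]"
| pentagon: "i \<in> I \<Longrightarrow> j \<in> I \<Longrightarrow> \<epsilon> i j = 1 \<or> \<epsilon> i j = - 1 \<Longrightarrow>
    basic_relation I \<epsilon> [Mut i, Mut j, Mut i, Mut j, Mut i] [Perm (transpose i j)]"
| perm_comp: "\<sigma> permutes I \<Longrightarrow> \<tau> permutes I \<Longrightarrow>
    basic_relation I \<epsilon> [Perm \<sigma>, Perm \<tau>] [Perm (\<sigma> \<circ> \<tau>)]"
| perm_id: "basic_relation I \<epsilon> [Perm id] []"

definition elementary_move ::
    "'i set \<Rightarrow> 'i matrix \<Rightarrow> 'i mutation_sequence \<Rightarrow> 'i mutation_sequence \<Rightarrow> bool" where
  "elementary_move I \<epsilon> w w' \<longleftrightarrow> w \<in> mutation_loops I \<epsilon> \<and> w' \<in> mutation_loops I \<epsilon> \<and>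
     (\<exists>u v a b. w = u @ a @ v \<and> w' = u @ b @ v \<and> basic_relation I (apply_sequence v \<epsilon>) a b)"

definition loop_equiv :: "'i set \<Rightarrow> 'i matrix \<Rightarrow> 'i mutation_sequence rel" where
  "loop_equiv I \<epsilon> = {(w, w'). w \<in> mutation_loops I \<epsilon> \<and> w' \<in> mutation_loops I \<epsilon> \<and>
     equivclp (elementary_move I \<epsilon>) w w'}"

definition loop_class :: "'i set \<Rightarrow> 'i matrix \<Rightarrow> 'i mutation_sequence \<Rightarrow> 'i mutation_sequence set"
  where "loop_class I \<epsilon> w = loop_equiv I \<epsilon> `` {w}"

definition saturated_cluster_modular_group ::
    "'i set \<Rightarrow> 'i matrix \<Rightarrow> 'i mutation_sequence set monoid" where
  "saturated_cluster_modular_group I \<epsilon> =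
     \<lparr>carrier = mutation_loops I \<epsilon> // loop_equiv I \<epsilon>,
      monoid.mult = (\<lambda>X Y. \<Union>x\<in>X. \<Union>y\<in>Y. loop_class I \<epsilon> (x @ y)),
      one = loop_class I \<epsilon> []\<rparr>"

section \<open>Abelianization\<close>

definition abelianization :: "('a, 'b) monoid_scheme \<Rightarrow> 'a set monoid" where
  "abelianization G = G Mod derived G (carrier G)"

definition abelianization_map :: "('a, 'b) monoid_scheme \<Rightarrow> 'a \<Rightarrow> 'a set" where
  "abelianization_map G x = derived G (carrier G) #>\<^bsub>G\<^esub> x"

section \<open>The quiver \<open>X\<^sub>7\<close>\<close>

definition X7_vertices :: "nat set" where
  "X7_vertices = {0..6}"

definition X7_arrows :: "nat \<Rightarrow> nat \<Rightarrow> int" where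
  "X7_arrows i j =
     (if i = 0 \<and> j \<in> {1, 3, 5} then 1
      else if i \<in> {1, 3, 5} \<and> j = i + 1 then 2
      else if i \<in> {2, 4, 6} \<and> j = 0 then 1
      else 0)"

definition X7 :: "nat matrix" where
  "X7 i j = X7_arrows i j - X7_arrows j i"

definition \<Gamma>_X7 :: "nat mutation_sequence set monoid" where
  "\<Gamma>_X7 = saturated_cluster_modular_group X7_vertices X7"

text \<open>\<open>cycle_of_list [a, b, c]\<close> maps \<open>a\<close> to \<open>b\<close>, \<open>b\<close> to \<open>c\<close> and \<open>c\<close> to \<open>a\<close>.\<close>

definition \<psi>\<^sub>1 :: "nat mutation_sequence" where
  "\<psi>\<^sub>1 = [Perm (cycle_of_list [0, 1, 2] \<circ> cycle_of_list [3, 4, 5, 6]), Mut 2, Mut 1, Mut 0]"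

definition \<sigma>\<^sub>1\<^sub>3 :: "nat mutation_sequence" where
  "\<sigma>\<^sub>1\<^sub>3 = [Perm (transpose 1 3 \<circ> transpose 2 4)]"

section \<open>Well-definedness\<close>

lemma mutate_mutate [simp]: "mutate k (mutate k \<epsilon>) = \<epsilon>"
proof (intro ext)
  fix i j
  have "even (\<bar>a\<bar> * b + a * \<bar>b\<bar>)" for a b :: int
    by (cases "a \<ge> 0"; cases "b \<ge> 0") (auto simp: algebra_simps)
  then have "(- (\<bar>a\<bar> * b) - a * \<bar>b\<bar>) div 2 = - ((\<bar>a\<bar> * b + a * \<bar>b\<bar>) div 2)" for a b :: int
    by (metis add_uminus_conv_diff dvd_neg_div minus_add_distrib)
  then show "mutate k (mutate k \<epsilon>) i j = \<epsilon> i j"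
    by (simp add: mutate_def)
qed

lemma permute_matrix_inv [simp]: "\<sigma> permutes I \<Longrightarrow> permute_matrix (inv_into UNIV \<sigma>) (permute_matrix \<sigma> \<epsilon>) = \<epsilon>"
  by (simp add: permute_matrix_def permutes_inv_inv permutes_inverses)

lemma apply_sequence_simps [simp]:
  "apply_sequence [] \<epsilon> = \<epsilon>"
  "apply_sequence (l # w) \<epsilon> = apply_letter l (apply_sequence w \<epsilon>)"
  "apply_sequence (u @ v) \<epsilon> = apply_sequence u (apply_sequence v \<epsilon>)"
  by (simp_all add: apply_sequence_def)

lemma mutation_sequences_simps [simp]:
  "[] \<in> mutation_sequences I"
  "Mut k # w \<in> mutation_sequences I \<longleftrightarrow> k \<in> I \<and> w \<in> mutation_sequences I"
  "Perm \<sigma> # w \<in> mutation_sequences I \<longleftrightarrow> \<sigma> permutes I \<and> w \<in> mutation_sequences I"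
  "u @ v \<in> mutation_sequences I \<longleftrightarrow> u \<in> mutation_sequences I \<and> v \<in> mutation_sequences I"
  by (auto simp: mutation_sequences_def)

lemma Nil_in_mutation_loops [simp]: "[] \<in> mutation_loops I \<epsilon>"
  by (simp add: mutation_loops_def)

lemma append_in_mutation_loops [simp]:
  "x \<in> mutation_loops I \<epsilon> \<Longrightarrow> y \<in> mutation_loops I \<epsilon> \<Longrightarrow> x @ y \<in> mutation_loops I \<epsilon>"
  by (simp add: mutation_loops_def)

lemma equiv_loop_equiv: "equiv (mutation_loops I \<epsilon>) (loop_equiv I \<epsilon>)"
  by (rule equivI)
     (auto simp: loop_equiv_def refl_on_def sym_def trans_def intro: equivclp_sym equivclp_trans)

lemma elementary_moveI:
  assumes "basic_relation I (apply_sequence v \<epsilon>) a b"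
    and "u @ a @ v \<in> mutation_loops I \<epsilon>" "u @ b @ v \<in> mutation_loops I \<epsilon>"
  shows "elementary_move I \<epsilon> (u @ a @ v) (u @ b @ v)"
  using assms unfolding elementary_move_def by blast

lemma elementary_move_append:
  assumes "elementary_move I \<epsilon> w w'" "x \<in> mutation_loops I \<epsilon>" "y \<in> mutation_loops I \<epsilon>"
  shows "elementary_move I \<epsilon> (x @ w @ y) (x @ w' @ y)"
proof -
  from assms(1) obtain u v a b where
    "w \<in> mutation_loops I \<epsilon>" "w' \<in> mutation_loops I \<epsilon>"
    and w: "w = u @ a @ v" "w' = u @ b @ v" "basic_relation I (apply_sequence v \<epsilon>) a b"
    unfolding elementary_move_def by blast
  moreover have "apply_sequence (v @ y) \<epsilon> = apply_sequence v \<epsilon>"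
    using assms(3) by (simp add: mutation_loops_def)
  ultimately show ?thesis
    using elementary_moveI[of I "v @ y" \<epsilon> a b "x @ u"] assms(2,3)
    by (simp add: mutation_loops_def)
qed

lemma loop_equiv_append:
  assumes "(w, w') \<in> loop_equiv I \<epsilon>" "x \<in> mutation_loops I \<epsilon>" "y \<in> mutation_loops I \<epsilon>"
  shows "(x @ w @ y, x @ w' @ y) \<in> loop_equiv I \<epsilon>"
proof -
  have "equivclp (elementary_move I \<epsilon>) w w'"
    using assms(1) by (simp add: loop_equiv_def)
  then have "equivclp (elementary_move I \<epsilon>) (x @ w @ y) (x @ w' @ y)"
  proof (induction rule: equivclp_induct)
    case base
    then show ?case by simp
  next
    case (step z z')
    then show ?case
      using elementary_move_append[OF _ assms(2,3)] by (blast intro: equivclp_into_equivclp)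
  qed
  then show ?thesis
    using assms by (simp add: loop_equiv_def)
qed

lemma mult_loop_class:
  assumes "x \<in> mutation_loops I \<epsilon>" "y \<in> mutation_loops I \<epsilon>"
  shows "loop_class I \<epsilon> x \<otimes>\<^bsub>saturated_cluster_modular_group I \<epsilon>\<^esub> loop_class I \<epsilon> y
    = loop_class I \<epsilon> (x @ y)"
proof -
  note E = equiv_loop_equiv[of I \<epsilon>]
  have "loop_class I \<epsilon> (x' @ y') = loop_class I \<epsilon> (x @ y)"
    if "(x, x') \<in> loop_equiv I \<epsilon>" "(y, y') \<in> loop_equiv I \<epsilon>" for x' y'
  proof -
    have "x' \<in> mutation_loops I \<epsilon>"
      using that by (simp add: loop_equiv_def)
    then have "(x @ y, x' @ y) \<in> loop_equiv I \<epsilon>" "(x' @ y, x' @ y') \<in> loop_equiv I \<epsilon>"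
      using loop_equiv_append[OF that(1), of "[]" y] loop_equiv_append[OF that(2), of x' "[]"] assms
      by simp_all
    then show ?thesis
      unfolding loop_class_def using equiv_class_eq[OF E] by metis
  qed
  then have const: "loop_class I \<epsilon> (x' @ y') = loop_class I \<epsilon> (x @ y)"
    if "x' \<in> loop_class I \<epsilon> x" "y' \<in> loop_class I \<epsilon> y" for x' y'
    using that by (simp add: loop_class_def)
  have self: "x \<in> loop_class I \<epsilon> x" "y \<in> loop_class I \<epsilon> y"
    using assms by (auto simp: loop_class_def loop_equiv_def)
  have "(\<Union>x'\<in>loop_class I \<epsilon> x. \<Union>y'\<in>loop_class I \<epsilon> y. loop_class I \<epsilon> (x' @ y'))
    = loop_class I \<epsilon> (x @ y)"
    using self by (intro equalityI UN_least) (blast dest: const)+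
  then show ?thesis
    by (simp add: saturated_cluster_modular_group_def)
qed

fun inverse_letter :: "'i letter \<Rightarrow> 'i letter" where
  "inverse_letter (Mut k) = Mut k"
| "inverse_letter (Perm \<sigma>) = Perm (inv_into UNIV \<sigma>)"

definition inverse_sequence :: "'i mutation_sequence \<Rightarrow> 'i mutation_sequence" where
  "inverse_sequence w = rev (map inverse_letter w)"

lemma inverse_sequence:
  assumes "w \<in> mutation_sequences I"
  shows "inverse_sequence w \<in> mutation_sequences I"
    and "apply_sequence (inverse_sequence w) (apply_sequence w \<epsilon>) = \<epsilon>"
    and "equivclp (elementary_move I \<epsilon>) (inverse_sequence w @ w) []"
proof -
  have "inverse_sequence w \<in> mutation_sequences I \<and>
    apply_sequence (inverse_sequence w) (apply_sequence w \<epsilon>) = \<epsilon> \<and>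
    equivclp (elementary_move I \<epsilon>) (inverse_sequence w @ w) []"
    using assms
  proof (induction w)
    case Nil
    then show ?case by (simp add: inverse_sequence_def)
  next
    case (Cons l w)
    let ?v = "inverse_sequence w"
    have w: "w \<in> mutation_sequences I"
      using Cons.prems by (cases l) simp_all
    then have IH: "?v \<in> mutation_sequences I" "apply_sequence ?v (apply_sequence w \<epsilon>) = \<epsilon>"
      "equivclp (elementary_move I \<epsilon>) (?v @ w) []"
      using Cons.IH by blast+
    have inv: "inverse_sequence (l # w) = ?v @ [inverse_letter l]"
      by (simp add: inverse_sequence_def)
    have "equivclp (elementary_move I \<epsilon>) (?v @ [inverse_letter l, l] @ w) (?v @ w)"
    proof (cases l)
      case (Mut k)
      then have "elementary_move I \<epsilon> (?v @ [Mut k, Mut k] @ w) (?v @ [] @ w)"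
        using Cons.prems IH w
        by (intro elementary_moveI)
           (auto simp: mutation_loops_def intro: basic_relation.intros)
      then show ?thesis using Mut by auto
    next
      case (Perm \<sigma>)
      then have \<sigma>: "\<sigma> permutes I" using Cons.prems by simp
      then have id: "inv_into UNIV \<sigma> \<circ> \<sigma> = id" and perm: "inv_into UNIV \<sigma> permutes I"
        by (simp_all add: permutes_inv_o permutes_inv)
      have rel: "basic_relation I \<delta> [Perm (inv_into UNIV \<sigma>), Perm \<sigma>] [Perm id]" for \<delta>
        using basic_relation.perm_comp[OF perm \<sigma>] id by simp
      have "elementary_move I \<epsilon> (?v @ [Perm (inv_into UNIV \<sigma>), Perm \<sigma>] @ w) (?v @ [Perm id] @ w)"
        using IH w \<sigma> perm
        by (intro elementary_moveI rel)
           (auto simp: mutation_loops_def permutes_id permute_matrix_def[of id])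
      moreover have "elementary_move I \<epsilon> (?v @ [Perm id] @ w) (?v @ [] @ w)"
        using IH w
        by (intro elementary_moveI basic_relation.perm_id)
           (auto simp: mutation_loops_def permutes_id permute_matrix_def[of id])
      ultimately have "equivclp (elementary_move I \<epsilon>) (?v @ [Perm (inv_into UNIV \<sigma>), Perm \<sigma>] @ w) (?v @ [] @ w)"
        by (meson equivclp_trans r_into_equivclp)
      then show ?thesis using Perm by simp
    qed
    moreover have "apply_letter (inverse_letter l) (apply_letter l \<delta>) = \<delta>" for \<delta>
      using Cons.prems by (cases l) auto
    moreover have "[inverse_letter l] \<in> mutation_sequences I"
      using Cons.prems by (cases l) (auto simp: permutes_inv)
    ultimately show ?case
      using IH unfolding inv by (auto intro: equivclp_trans)
  qed
  then show "inverse_sequence w \<in> mutation_sequences I"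
    and "apply_sequence (inverse_sequence w) (apply_sequence w \<epsilon>) = \<epsilon>"
    and "equivclp (elementary_move I \<epsilon>) (inverse_sequence w @ w) []"
    by blast+
qed

lemma carrier_saturated_cluster_modular_group:
  "carrier (saturated_cluster_modular_group I \<epsilon>) = loop_class I \<epsilon> ` mutation_loops I \<epsilon>"
  by (auto simp: saturated_cluster_modular_group_def loop_class_def quotient_def)

lemma group_saturated_cluster_modular_group: "group (saturated_cluster_modular_group I \<epsilon>)"
  (is "group ?G")
proof (rule groupI)
  have one: "\<one>\<^bsub>?G\<^esub> = loop_class I \<epsilon> []"
    by (simp add: saturated_cluster_modular_group_def)
  show "\<one>\<^bsub>?G\<^esub> \<in> carrier ?G"
    by (simp add: one carrier_saturated_cluster_modular_group)
  fix X assume "X \<in> carrier ?G"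
  then obtain x where x: "x \<in> mutation_loops I \<epsilon>" "X = loop_class I \<epsilon> x"
    by (auto simp: carrier_saturated_cluster_modular_group)
  show "\<one>\<^bsub>?G\<^esub> \<otimes>\<^bsub>?G\<^esub> X = X"
    using mult_loop_class[OF Nil_in_mutation_loops x(1)] x one by simp
  let ?y = "inverse_sequence x"
  have "x \<in> mutation_sequences I" "apply_sequence x \<epsilon> = \<epsilon>"
    using x by (simp_all add: mutation_loops_def)
  note inv = inverse_sequence(1)[OF this(1)] inverse_sequence(2,3)[OF this(1), of \<epsilon>] this
  have y: "?y \<in> mutation_loops I \<epsilon>"
    using inv by (simp add: mutation_loops_def)
  then have "(?y @ x, []) \<in> loop_equiv I \<epsilon>"
    using inv x append_in_mutation_loops[OF y x(1)]
    by (simp add: loop_equiv_def)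
  then have "loop_class I \<epsilon> (?y @ x) = loop_class I \<epsilon> []"
    unfolding loop_class_def by (rule equiv_class_eq[OF equiv_loop_equiv])
  then show "\<exists>Y\<in>carrier ?G. Y \<otimes>\<^bsub>?G\<^esub> X = \<one>\<^bsub>?G\<^esub>"
    using mult_loop_class[OF y x(1)] x y one
    by (auto simp: carrier_saturated_cluster_modular_group)
  fix Y assume "Y \<in> carrier ?G"
  then obtain y where y: "y \<in> mutation_loops I \<epsilon>" "Y = loop_class I \<epsilon> y"
    by (auto simp: carrier_saturated_cluster_modular_group)
  show "X \<otimes>\<^bsub>?G\<^esub> Y \<in> carrier ?G"
    using x y by (simp add: mult_loop_class carrier_saturated_cluster_modular_group)
  fix Z assume "Z \<in> carrier ?G"
  then obtain z where z: "z \<in> mutation_loops I \<epsilon>" "Z = loop_class I \<epsilon> z"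
    by (auto simp: carrier_saturated_cluster_modular_group)
  show "X \<otimes>\<^bsub>?G\<^esub> Y \<otimes>\<^bsub>?G\<^esub> Z = X \<otimes>\<^bsub>?G\<^esub> (Y \<otimes>\<^bsub>?G\<^esub> Z)"
    using x y z by (simp add: mult_loop_class)
qed

lemma X7_arrows_eq_0: "i \<notin> X7_vertices \<or> j \<notin> X7_vertices \<Longrightarrow> X7_arrows i j = 0"
proof -
  have "i \<in> X7_vertices \<and> j \<in> X7_vertices" if "X7_arrows i j \<noteq> 0"
  proof -
    from that have "i = 0 \<and> j \<in> {1, 3, 5} \<or> i \<in> {1, 3, 5} \<and> j = i + 1 \<or> i \<in> {2, 4, 6} \<and> j = 0"
      unfolding X7_arrows_def by presburger
    then show ?thesis
      unfolding X7_vertices_def by auto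
  qed
  then show "i \<notin> X7_vertices \<or> j \<notin> X7_vertices \<Longrightarrow> X7_arrows i j = 0"
    by blast
qed

lemma exchange_matrix_X7: "exchange_matrix X7_vertices X7"
  unfolding exchange_matrix_def
proof (intro conjI allI impI)
  show "finite X7_vertices"
    by (simp add: X7_vertices_def)
  show "X7 i j = - X7 j i" for i j
    by (simp add: X7_def)
  show "X7 i j = 0" if "i \<notin> X7_vertices \<or> j \<notin> X7_vertices" for i j
    using that X7_arrows_eq_0[of i j] X7_arrows_eq_0[of j i] unfolding X7_def by linarith
qed

definition matrix_of_rows :: "int list list \<Rightarrow> nat matrix" where
  "matrix_of_rows L = (\<lambda>i j. if i < 7 \<and> j < 7 then L ! i ! j else 0)"

lemma all_less_7: "(\<forall>i<7. P i) \<longleftrightarrow> P 0 \<and> P 1 \<and> P 2 \<and> P 3 \<and> P 4 \<and> P 5 \<and> P (6 :: nat)"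
proof -
  have "{..<7 :: nat} = {0, 1, 2, 3, 4, 5, 6}"
    by auto
  then have "(\<forall>i\<in>{..<7}. P i) \<longleftrightarrow> (\<forall>i\<in>{0, 1, 2, 3, 4, 5, 6}. P i)"
    by (rule arg_cong)
  moreover have "(\<forall>i<7. P i) \<longleftrightarrow> (\<forall>i\<in>{..<7}. P i)"
    by (simp only: Ball_def lessThan_iff)
  ultimately show ?thesis
    by (simp only: ball_simps simp_thms)
qed

lemma matrix_of_rows_eqI:
  assumes "exchange_matrix X7_vertices \<delta>" "\<forall>i<7. \<forall>j<7. \<delta> i j = L ! i ! j"
  shows "\<delta> = matrix_of_rows L"
proof (intro ext)
  fix i j
  show "\<delta> i j = matrix_of_rows L i j"
  proof (cases "i < 7 \<and> j < 7")
    case True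
    then show ?thesis
      using assms(2) by (simp add: matrix_of_rows_def)
  next
    case False
    then have "i \<notin> X7_vertices \<or> j \<notin> X7_vertices"
      unfolding X7_vertices_def atLeastAtMost_iff by linarith
    then have "\<delta> i j = 0"
      using assms(1) unfolding exchange_matrix_def by blast
    then show ?thesis
      using False unfolding matrix_of_rows_def by presburger
  qed
qed

lemma X7_rows: "X7 = matrix_of_rows
    [[0, 1, - 1, 1, - 1, 1, - 1],
     [- 1, 0, 2, 0, 0, 0, 0],
     [1, - 2, 0, 0, 0, 0, 0],
     [- 1, 0, 0, 0, 2, 0, 0],
     [1, 0, 0, - 2, 0, 0, 0],
     [- 1, 0, 0, 0, 0, 0, 2],
     [1, 0, 0, 0, 0, - 2, 0]]"
  by (rule matrix_of_rows_eqI[OF exchange_matrix_X7], unfold all_less_7 X7_def X7_arrows_def, simp)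

lemma mutate_matrix_of_rows:
  assumes "\<forall>i<7. \<forall>j<7. L' ! i ! j = (if i = k \<or> j = k then - L ! i ! j
      else L ! i ! j + (\<bar>L ! i ! k\<bar> * L ! k ! j + L ! i ! k * \<bar>L ! k ! j\<bar>) div 2)"
    and "k < 7"
  shows "mutate k (matrix_of_rows L) = matrix_of_rows L'"
proof (intro ext)
  fix i j
  show "mutate k (matrix_of_rows L) i j = matrix_of_rows L' i j"
  proof (cases "i < 7 \<and> j < 7")
    case True
    then show ?thesis
      using assms by (simp add: mutate_def matrix_of_rows_def)
  next
    case False
    then have "matrix_of_rows L a b = 0" if "(a, b) = (i, j)" for a b
      using that by (auto simp: matrix_of_rows_def)
    moreover have "matrix_of_rows L i k = 0 \<or> matrix_of_rows L k j = 0" "matrix_of_rows L' i j = 0"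
      using False by (auto simp: matrix_of_rows_def)
    ultimately show ?thesis
      unfolding mutate_def by auto
  qed
qed

lemma permute_matrix_of_rows:
  assumes "\<sigma> permutes X7_vertices" "\<forall>i<7. \<forall>j<7. L ! i ! j = L' ! (\<sigma> i) ! (\<sigma> j)"
  shows "permute_matrix \<sigma> (matrix_of_rows L) = matrix_of_rows L'"
proof (intro ext)
  fix i j
  have less: "inv_into UNIV \<sigma> i < 7 \<longleftrightarrow> i < 7" for i
    using permutes_in_image[OF permutes_inv[OF assms(1)], of i] by (auto simp: X7_vertices_def)
  show "permute_matrix \<sigma> (matrix_of_rows L) i j = matrix_of_rows L' i j"
    using assms by (simp add: permute_matrix_def matrix_of_rows_def less permutes_inverses)
qed

lemma \<psi>\<^sub>1_in_mutation_loops: "\<psi>\<^sub>1 \<in> mutation_loops X7_vertices X7"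
proof -
  let ?c = "cycle_of_list [0, 1, 2] \<circ> cycle_of_list [3, 4, 5, 6 :: nat]"
  have perm: "?c permutes X7_vertices"
    by (intro permutes_compose permutes_subset[OF cycle_permutes]) (auto simp: X7_vertices_def)
  have 1: "mutate 0 X7 = matrix_of_rows
    [[0, - 1, 1, - 1, 1, - 1, 1],
     [1, 0, 1, 0, - 1, 0, - 1],
     [- 1, - 1, 0, 1, 0, 1, 0],
     [1, 0, - 1, 0, 1, 0, - 1],
     [- 1, 1, 0, - 1, 0, 1, 0],
     [1, 0, - 1, 0, - 1, 0, 1],
     [- 1, 1, 0, 1, 0, - 1, 0]]"
    unfolding X7_rows by (rule mutate_matrix_of_rows, unfold all_less_7) simp_all
  have 2: "mutate 1 (mutate 0 X7) = matrix_of_rows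
    [[0, 1, 1, - 1, 0, - 1, 0],
     [- 1, 0, - 1, 0, 1, 0, 1],
     [- 1, 1, 0, 1, - 1, 1, - 1],
     [1, 0, - 1, 0, 1, 0, - 1],
     [0, - 1, 1, - 1, 0, 1, 0],
     [1, 0, - 1, 0, - 1, 0, 1],
     [0, - 1, 1, 1, 0, - 1, 0]]"
    unfolding 1 by (rule mutate_matrix_of_rows, unfold all_less_7) simp_all
  have 3: "mutate 2 (mutate 1 (mutate 0 X7)) = matrix_of_rows
    [[0, 2, - 1, 0, 0, 0, 0],
     [- 2, 0, 1, 0, 0, 0, 0],
     [1, - 1, 0, - 1, 1, - 1, 1],
     [0, 0, 1, 0, 0, 0, - 2],
     [0, 0, - 1, 0, 0, 2, 0],
     [0, 0, 1, 0, - 2, 0, 0],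
     [0, 0, - 1, 2, 0, 0, 0]]"
    unfolding 2 by (rule mutate_matrix_of_rows, unfold all_less_7) simp_all
  have "permute_matrix ?c (mutate 2 (mutate 1 (mutate 0 X7))) = X7"
    unfolding 3 unfolding X7_rows
    by (rule permute_matrix_of_rows[OF perm], unfold all_less_7, simp add: transpose_def)
  then show ?thesis
    using perm by (simp add: \<psi>\<^sub>1_def mutation_loops_def X7_vertices_def)
qed

lemma \<sigma>\<^sub>1\<^sub>3_in_mutation_loops: "\<sigma>\<^sub>1\<^sub>3 \<in> mutation_loops X7_vertices X7"
proof -
  let ?s = "transpose 1 3 \<circ> transpose 2 (4 :: nat)"
  have perm: "?s permutes X7_vertices"
    by (intro permutes_compose permutes_swap_id) (auto simp: X7_vertices_def)
  have "permute_matrix ?s X7 = X7"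
    unfolding X7_rows
    by (rule permute_matrix_of_rows[OF perm], unfold all_less_7, simp add: transpose_def)
  then show ?thesis
    using perm by (simp add: \<sigma>\<^sub>1\<^sub>3_def mutation_loops_def)
qed

end

theory Submission
  imports Defs
begin

text \<open>
  Up to isomorphism the mutation class of \<open>X\<^sub>7\<close> contains two quivers, \<open>X\<^sub>7\<close> and its mutation at the
  central vertex \<open>0\<close>. The six other vertices form three pairs, and both quivers have the symmetric
  group on these pairs as automorphism group. Identifying each quiver reached by a mutation sequence
  with one of the two models gives a frame, and every mutation becomes a mutation of a model at one of
  its positions, followed by a choice of a new frame among six.
  
  The choices can be made such that all relations preserve frames up to a rotation of the three pairs;
  in other words, the cyclic order of the pairs can be transported along mutation sequences. A loop
  ends with an automorphism of \<open>X\<^sub>7\<close>, and the parity of its permutation of the pairs is a homomorphism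
  to \<open>\<int>/2\<close>. A homomorphism to \<open>\<int>/5\<close> arises by adding up weights of the mutations: \<open>0\<close> at the centre,
  \<open>\<plusminus> 1\<close> for the second model and \<open>\<plusminus> 2\<close> for \<open>X\<^sub>7\<close>, with the sign distinguishing the two vertices of a
  pair. That the relations preserve both quantities is, thanks to the independence of labels, a finite
  computation with the two models (\<open>basic_relation_equal_up_to\<close>). Together they form the homomorphism
  \<open>invariant\<close>, which sends \<open>\<psi>\<^sub>1\<close> to \<open>(1, 0)\<close> and \<open>\<sigma>\<^sub>1\<^sub>3\<close> to \<open>(0, 1)\<close>.
  
  Conversely, let \<open>q\<close> be a homomorphism from the group to a commutative group. Returning to \<open>X\<^sub>7\<close>
  along a standard path after every letter of a loop expresses the loop by an automorphism of \<open>X\<^sub>7\<close> and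
  by one elementary loop for each mutation (\<open>ratio_canonical_path\<close>). Conjugation by rotations leaves
  two elementary loops for each model, for the two vertices of a pair, and they are inverse to
  each other. A pentagon of \<open>X\<^sub>7\<close> expresses its elementary loop by the one of the second model, which
  is \<open>\<psi>\<^sub>1\<close>, and a pentagon of the second model yields \<open>q(\<psi>\<^sub>1)\<^sup>5 = 1\<close> (\<open>step_value_relations\<close>). The
  automorphisms contribute powers of \<open>q(\<sigma>\<^sub>1\<^sub>3)\<close>. Hence \<open>q\<close> is determined by \<open>invariant\<close>
  (\<open>character_formula\<close>), and for the map \<open>q\<close> to the abelianization this means that \<open>invariant\<close> induces
  an isomorphism.
\<close>

section \<open>Paths of mutations and their characters\<close>

text \<open>
  The relations of the group are only defined between loops, whereas its elements are best compared
  through their pieces. The same moves are therefore considered between arbitrary mutation sequences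
  with a common source \<open>\<epsilon>\<close> and a common target.
\<close>

definition path_move ::
    "'i set \<Rightarrow> 'i matrix \<Rightarrow> 'i mutation_sequence \<Rightarrow> 'i mutation_sequence \<Rightarrow> bool" where
  "path_move I \<epsilon> w w' \<longleftrightarrow> w \<in> mutation_sequences I \<and> w' \<in> mutation_sequences I \<and>
     apply_sequence w \<epsilon> = apply_sequence w' \<epsilon> \<and>
     (\<exists>u v a b. w = u @ a @ v \<and> w' = u @ b @ v \<and> basic_relation I (apply_sequence v \<epsilon>) a b)"

definition path_equiv ::
    "'i set \<Rightarrow> 'i matrix \<Rightarrow> 'i mutation_sequence \<Rightarrow> 'i mutation_sequence \<Rightarrow> bool" where
  "path_equiv I \<epsilon> = equivclp (path_move I \<epsilon>)"

lemma path_equiv_refl [simp]: "path_equiv I \<epsilon> w w"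
  by (simp add: path_equiv_def)

lemma path_equiv_sym: "path_equiv I \<epsilon> w w' \<Longrightarrow> path_equiv I \<epsilon> w' w"
  by (simp add: path_equiv_def equivclp_sym)

lemma path_equiv_trans [trans]:
  "path_equiv I \<epsilon> w w' \<Longrightarrow> path_equiv I \<epsilon> w' w'' \<Longrightarrow> path_equiv I \<epsilon> w w''"
  unfolding path_equiv_def by (rule equivclp_trans)

lemma path_equiv_basicI:
  assumes "basic_relation I \<epsilon> a b" "a \<in> mutation_sequences I" "b \<in> mutation_sequences I"
    and "apply_sequence a \<epsilon> = apply_sequence b \<epsilon>"
  shows "path_equiv I \<epsilon> a b"
proof -
  have "\<exists>u v a' b'. a = u @ a' @ v \<and> b = u @ b' @ v \<and> basic_relation I (apply_sequence v \<epsilon>) a' b'"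
    using assms(1) by (intro exI[of _ "[]"] exI[of _ a] exI[of _ b]) simp
  then have "path_move I \<epsilon> a b"
    using assms(2-4) unfolding path_move_def by blast
  then show ?thesis
    unfolding path_equiv_def by blast
qed

lemma path_equiv_congruence:
  assumes "path_equiv I (apply_sequence y \<epsilon>) w w'"
    and "x \<in> mutation_sequences I" "y \<in> mutation_sequences I"
  shows "path_equiv I \<epsilon> (x @ w @ y) (x @ w' @ y)"
proof -
  have move: "path_move I \<epsilon> (x @ z @ y) (x @ z' @ y)"
    if "path_move I (apply_sequence y \<epsilon>) z z'" for z z'
  proof -
    from that obtain u v a b where
      "z = u @ a @ v" "z' = u @ b @ v" "basic_relation I (apply_sequence (v @ y) \<epsilon>) a b"
      unfolding path_move_def by auto
    then have "\<exists>u v a b. x @ z @ y = u @ a @ v \<and> x @ z' @ y = u @ b @ v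
        \<and> basic_relation I (apply_sequence v \<epsilon>) a b"
      by (intro exI[of _ "x @ u"] exI[of _ "v @ y"] exI[of _ a] exI[of _ b]) simp
    then show ?thesis
      using that assms(2,3) unfolding path_move_def by simp
  qed
  from assms(1) show ?thesis
    unfolding path_equiv_def
  proof (induction rule: equivclp_induct)
    case base
    then show ?case by simp
  next
    case (step z z')
    then show ?case
      using move by (blast intro: equivclp_into_equivclp)
  qed
qed

lemma path_equiv_prefix:
  "path_equiv I \<epsilon> w w' \<Longrightarrow> x \<in> mutation_sequences I \<Longrightarrow> path_equiv I \<epsilon> (x @ w) (x @ w')"
  using path_equiv_congruence[of I "[]" \<epsilon> w w' x] by simp

lemma path_equiv_suffix:
  "path_equiv I (apply_sequence y \<epsilon>) w w' \<Longrightarrow> y \<in> mutation_sequences I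
    \<Longrightarrow> path_equiv I \<epsilon> (w @ y) (w' @ y)"
  using path_equiv_congruence[of I y \<epsilon> w w' "[]"] by simp

lemma path_equiv_invariants:
  assumes "path_equiv I \<epsilon> w w'"
  shows "apply_sequence w' \<epsilon> = apply_sequence w \<epsilon>"
    and "w' \<in> mutation_sequences I \<longleftrightarrow> w \<in> mutation_sequences I"
proof -
  have "apply_sequence w' \<epsilon> = apply_sequence w \<epsilon> \<and>
      (w' \<in> mutation_sequences I \<longleftrightarrow> w \<in> mutation_sequences I)"
    using assms unfolding path_equiv_def
    by (induction rule: equivclp_induct) (auto simp: path_move_def)
  then show "apply_sequence w' \<epsilon> = apply_sequence w \<epsilon>"
    and "w' \<in> mutation_sequences I \<longleftrightarrow> w \<in> mutation_sequences I"
    by blast+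
qed

text \<open>
  Nothing is lost by leaving the loops: a move never changes the target, so a chain of moves that
  starts at a loop passes through loops only.
\<close>

lemma path_equiv_imp_loop_equiv:
  assumes "path_equiv I \<epsilon> w w'" "w \<in> mutation_loops I \<epsilon>"
  shows "(w, w') \<in> loop_equiv I \<epsilon>"
proof -
  have "w' \<in> mutation_loops I \<epsilon> \<and> equivclp (elementary_move I \<epsilon>) w w'"
    using assms(1) unfolding path_equiv_def
  proof (induction rule: equivclp_induct)
    case base
    then show ?case using assms(2) by simp
  next
    case (step z z')
    then have "z' \<in> mutation_loops I \<epsilon>"
      by (auto simp: path_move_def mutation_loops_def)
    moreover from this step have "elementary_move I \<epsilon> z z' \<or> elementary_move I \<epsilon> z' z"
      unfolding path_move_def elementary_move_def by blast
    ultimately show ?case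
      using step by (blast intro: equivclp_into_equivclp)
  qed
  then show ?thesis
    using assms(2) by (simp add: loop_equiv_def)
qed

lemma elementary_move_imp_path_move: "elementary_move I \<epsilon> w w' \<Longrightarrow> path_move I \<epsilon> w w'"
  unfolding elementary_move_def path_move_def mutation_loops_def by auto

lemma elementary_equiv_imp_path_equiv:
  "equivclp (elementary_move I \<epsilon>) w w' \<Longrightarrow> path_equiv I \<epsilon> w w'"
  unfolding path_equiv_def
  by (induction rule: equivclp_induct)
     (auto intro: equivclp_into_equivclp elementary_move_imp_path_move)

lemma inverse_path_equiv:
  assumes "w \<in> mutation_sequences I"
  shows "path_equiv I \<epsilon> (inverse_sequence w @ w) []"
  by (intro elementary_equiv_imp_path_equiv inverse_sequence(3) assms)

lemma inverse_sequence_append [simp]: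
  "inverse_sequence (u @ v) = inverse_sequence v @ inverse_sequence u"
  by (simp add: inverse_sequence_def)

lemma inverse_sequence_inverse:
  "w \<in> mutation_sequences I \<Longrightarrow> inverse_sequence (inverse_sequence w) = w"
proof (induction w)
  case (Cons x w)
  then show ?case
    by (cases x) (auto simp: inverse_sequence_def rev_map permutes_inv_inv)
qed (simp add: inverse_sequence_def)

lemma path_equiv_inverse:
  assumes "w \<in> mutation_sequences I"
  shows "path_equiv I \<epsilon> (w @ inverse_sequence w) []"
  using inverse_path_equiv[OF inverse_sequence(1)[OF assms], of \<epsilon>]
  by (simp add: inverse_sequence_inverse[OF assms])

text \<open>
  Inversion is compatible with equivalence, because both inverses can be compared with
  \<open>u\<inverse> u' u'\<inverse>\<close>, in which \<open>u'\<close> may be exchanged for \<open>u\<close>.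
\<close>

lemma path_equiv_inverse_cong:
  assumes eq: "path_equiv I \<epsilon> u u'" and u: "u \<in> mutation_sequences I"
  shows "path_equiv I (apply_sequence u \<epsilon>) (inverse_sequence u) (inverse_sequence u')"
proof -
  let ?\<delta> = "apply_sequence u \<epsilon>" and ?u = "inverse_sequence u" and ?u' = "inverse_sequence u'"
  have u': "u' \<in> mutation_sequences I" "apply_sequence u' \<epsilon> = ?\<delta>"
    using path_equiv_invariants[OF eq] u by simp_all
  note inv = inverse_sequence(1)[OF u] inverse_sequence(1)[OF u'(1)]
  have "apply_sequence ?u' ?\<delta> = \<epsilon>"
    using inverse_sequence(2)[OF u'(1), of \<epsilon>] u'(2) by simp
  then have 1: "path_equiv I ?\<delta> (?u @ u @ ?u') (?u @ u' @ ?u')"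
    using eq inv by (intro path_equiv_congruence) simp_all
  have 2: "path_equiv I ?\<delta> (?u @ u' @ ?u') ?u"
    using path_equiv_prefix[OF path_equiv_inverse[OF u'(1)] inv(1)] by simp
  have 3: "path_equiv I ?\<delta> (?u @ u @ ?u') ?u'"
    using path_equiv_suffix[OF inverse_path_equiv[OF u] inv(2)] by simp
  show ?thesis
    using 1 2 3 by (meson path_equiv_sym path_equiv_trans)
qed

lemma permute_matrix_mutate:
  assumes "\<sigma> permutes I"
  shows "permute_matrix \<sigma> (mutate k \<epsilon>) = mutate (\<sigma> k) (permute_matrix \<sigma> \<epsilon>)"
proof -
  have "inv_into UNIV \<sigma> i = k \<longleftrightarrow> i = \<sigma> k" for i
    using permutes_inverses[OF assms] by metis
  then show ?thesis
    using permutes_inverses(2)[OF assms]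
    by (auto simp: permute_matrix_def mutate_def fun_eq_iff)
qed

lemma permute_matrix_comp:
  assumes "\<sigma> permutes I" "\<tau> permutes I"
  shows "permute_matrix (\<sigma> \<circ> \<tau>) \<epsilon> = permute_matrix \<sigma> (permute_matrix \<tau> \<epsilon>)"
  using assms by (simp add: permute_matrix_def permutes_bij o_inv_distrib)

lemma path_equiv_Perm_Perm:
  assumes "\<sigma> permutes I" "\<tau> permutes I"
  shows "path_equiv I \<epsilon> [Perm \<sigma>, Perm \<tau>] [Perm (\<sigma> \<circ> \<tau>)]"
  using assms
  by (intro path_equiv_basicI basic_relation.perm_comp)
     (auto simp: permute_matrix_comp permutes_compose)

lemma path_equiv_Perm_id: "path_equiv I \<epsilon> [Perm id] []"
  by (intro path_equiv_basicI basic_relation.perm_id)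
     (auto simp: permutes_id permute_matrix_def)

text \<open>
  The conjugation relation in the form used to move a permutation past a mutation; it is obtained by
  inserting \<open>\<sigma>\<inverse> \<sigma>\<close> on the right.
\<close>

lemma path_equiv_Perm_Mut:
  assumes "\<sigma> permutes I" "k \<in> I"
  shows "path_equiv I \<epsilon> [Perm \<sigma>, Mut k] [Mut (\<sigma> k), Perm \<sigma>]"
proof -
  let ?\<sigma>' = "inv_into UNIV \<sigma>"
  have perm: "?\<sigma>' permutes I" "\<sigma> k \<in> I"
    using assms by (simp_all add: permutes_inv permutes_in_image)
  have "path_equiv I \<epsilon> ([Perm \<sigma>, Mut k] @ [Perm ?\<sigma>', Perm \<sigma>]) [Perm \<sigma>, Mut k]"
    using path_equiv_prefix[OF inverse_path_equiv[of "[Perm \<sigma>]" I \<epsilon>], of "[Perm \<sigma>, Mut k]"] assms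
    by (simp add: inverse_sequence_def)
  moreover have "path_equiv I (apply_sequence [Perm \<sigma>] \<epsilon>) [Perm \<sigma>, Mut k, Perm ?\<sigma>'] [Mut (\<sigma> k)]"
    using assms perm by (intro path_equiv_basicI basic_relation.conjugation)
      (simp_all add: permute_matrix_mutate[OF assms(1)])
  then have "path_equiv I \<epsilon> ([Perm \<sigma>, Mut k, Perm ?\<sigma>'] @ [Perm \<sigma>]) ([Mut (\<sigma> k)] @ [Perm \<sigma>])"
    using assms by (intro path_equiv_suffix) simp_all
  ultimately show ?thesis
    by (auto intro: path_equiv_sym path_equiv_trans)
qed

subsection \<open>Characters\<close>

text \<open>
  Homomorphisms from the group into a commutative group, described on representing loops. The
  universal one is the map to the abelianization.
\<close>

locale loop_character = comm_group A for A (structure) +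
  fixes I :: "'i set" and \<epsilon> :: "'i matrix" and q :: "'i mutation_sequence \<Rightarrow> 'a"
  assumes character_closed [simp]: "w \<in> mutation_loops I \<epsilon> \<Longrightarrow> q w \<in> carrier A"
    and character_append: "x \<in> mutation_loops I \<epsilon> \<Longrightarrow> y \<in> mutation_loops I \<epsilon> \<Longrightarrow> q (x @ y) = q x \<otimes> q y"
    and character_equiv: "(x, y) \<in> loop_equiv I \<epsilon> \<Longrightarrow> q x = q y"
begin

definition parallel :: "'i mutation_sequence \<Rightarrow> 'i mutation_sequence \<Rightarrow> bool" where
  "parallel u v \<longleftrightarrow> u \<in> mutation_sequences I \<and> v \<in> mutation_sequences I \<and>
     apply_sequence u \<epsilon> = apply_sequence v \<epsilon>"

text \<open>
  Two paths \<open>u\<close> and \<open>v\<close> with the same ends differ by the loop \<open>u\<inverse> v\<close>. The value of a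
  character on this loop measures their difference; it behaves like a quotient \<open>v / u\<close>.
\<close>

definition ratio :: "'i mutation_sequence \<Rightarrow> 'i mutation_sequence \<Rightarrow> 'a" where
  "ratio u v = q (inverse_sequence u @ v)"

lemma character_path_equiv:
  "path_equiv I \<epsilon> x y \<Longrightarrow> x \<in> mutation_loops I \<epsilon> \<Longrightarrow> q x = q y"
  by (intro character_equiv path_equiv_imp_loop_equiv)

lemma character_Nil [simp]: "q [] = \<one>"
  using character_append[of "[]" "[]"] character_closed[of "[]"] l_cancel_one by fastforce

lemma inverse_append_loop: "parallel u v \<Longrightarrow> inverse_sequence u @ v \<in> mutation_loops I \<epsilon>"
  unfolding parallel_def mutation_loops_def
  by (simp add: inverse_sequence(1)) (metis inverse_sequence(2))

lemma ratio_closed [simp]: "parallel u v \<Longrightarrow> ratio u v \<in> carrier A"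
  unfolding ratio_def by (intro character_closed inverse_append_loop)

lemma ratio_path_equiv:
  assumes "path_equiv I \<epsilon> u u'" "path_equiv I \<epsilon> v v'" "parallel u v"
  shows "ratio u v = ratio u' v'"
proof -
  have u: "u \<in> mutation_sequences I" "v \<in> mutation_sequences I" "apply_sequence u \<epsilon> = apply_sequence v \<epsilon>"
    and u': "u' \<in> mutation_sequences I"
    using assms path_equiv_invariants(2)[OF assms(1)] by (auto simp: parallel_def)
  have "path_equiv I \<epsilon> (inverse_sequence u @ v) (inverse_sequence u' @ v)"
    using path_equiv_inverse_cong[OF assms(1)] u by (intro path_equiv_suffix) simp_all
  moreover have "path_equiv I \<epsilon> (inverse_sequence u' @ v) (inverse_sequence u' @ v')"
    using assms(2) u' by (intro path_equiv_prefix inverse_sequence(1))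
  ultimately show ?thesis
    unfolding ratio_def
    by (intro character_path_equiv inverse_append_loop assms) (rule path_equiv_trans)
qed

lemma ratio_cancel:
  assumes "parallel u v" "parallel v w"
  shows "ratio u v \<otimes> ratio v w = ratio u w"
proof -
  have mem: "u \<in> mutation_sequences I" "v \<in> mutation_sequences I" "w \<in> mutation_sequences I"
    using assms by (simp_all add: parallel_def)
  have eq: "apply_sequence v \<epsilon> = apply_sequence w \<epsilon>"
    using assms by (simp add: parallel_def)
  have "ratio u v \<otimes> ratio v w = q ((inverse_sequence u @ v) @ (inverse_sequence v @ w))"
    unfolding ratio_def using assms by (simp only: character_append inverse_append_loop)
  also have "\<dots> = q (inverse_sequence u @ (v @ inverse_sequence v) @ w)"
    by simp
  also have "\<dots> = q (inverse_sequence u @ [] @ w)"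
  proof (rule character_path_equiv)
    show "path_equiv I \<epsilon> (inverse_sequence u @ (v @ inverse_sequence v) @ w) (inverse_sequence u @ [] @ w)"
      using mem by (intro path_equiv_congruence path_equiv_inverse inverse_sequence(1))
    show "inverse_sequence u @ (v @ inverse_sequence v) @ w \<in> mutation_loops I \<epsilon>"
      using append_in_mutation_loops[OF assms[THEN inverse_append_loop]] by simp
  qed
  finally show ?thesis
    by (simp add: ratio_def)
qed

lemma ratio_refl [simp]: "u \<in> mutation_sequences I \<Longrightarrow> ratio u u = \<one>"
  using character_path_equiv[OF inverse_path_equiv[of u I \<epsilon>]] inverse_append_loop[of u u]
  by (simp add: ratio_def parallel_def)

lemma ratio_append_loop:
  assumes "u \<in> mutation_sequences I" "x \<in> mutation_loops I \<epsilon>"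
  shows "ratio u (u @ x) = q x"
proof -
  have "path_equiv I \<epsilon> ((inverse_sequence u @ u) @ x) ([] @ x)"
    using assms by (intro path_equiv_suffix inverse_path_equiv) (simp_all add: mutation_loops_def)
  moreover have "parallel u (u @ x)"
    using assms by (simp add: parallel_def mutation_loops_def)
  note inverse_append_loop[OF this]
  ultimately show ?thesis
    unfolding ratio_def using character_path_equiv by force
qed

lemma ratio_prefix:
  assumes "parallel u v" "x \<in> mutation_sequences I"
  shows "ratio (x @ u) (x @ v) = ratio u v"
proof -
  have "path_equiv I \<epsilon> (inverse_sequence u @ (inverse_sequence x @ x) @ v) (inverse_sequence u @ [] @ v)"
    using assms by (intro path_equiv_congruence inverse_path_equiv inverse_sequence(1))
      (simp_all add: parallel_def)
  moreover have "parallel (x @ u) (x @ v)"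
    using assms by (simp add: parallel_def)
  note inverse_append_loop[OF this]
  ultimately show ?thesis
    unfolding ratio_def using character_path_equiv by simp
qed

end

section \<open>Frames\<close>

text \<open>
  The quivers that can be reached from \<open>X\<^sub>7\<close> are isomorphic to \<open>X\<^sub>7\<close> or to its mutation at the
  vertex \<open>0\<close>. A frame is such a quiver together with an isomorphism from the model: the boolean tells
  whether the model is \<open>X\<^sub>7\<close>, and the list gives the label of each of the positions \<open>0, \<dots>, 6\<close> of the
  model. Position \<open>0\<close> is the centre, and the other positions form the pairs \<open>{1, 2}\<close>, \<open>{3, 4}\<close>,
  \<open>{5, 6}\<close>.
\<close>

type_synonym frame = "bool \<times> nat list"

definition positions :: "nat list" where
  "positions = [0, 1, 2, 3, 4, 5, 6]"

text \<open>
  With lists read as maps, this is the composition of \<open>l\<close> after \<open>r\<close>.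
\<close>

definition reindex :: "nat list \<Rightarrow> nat list \<Rightarrow> nat list" where
  "reindex l r = map ((!) l) r"

fun position :: "nat list \<Rightarrow> nat \<Rightarrow> nat" where
  "position [] k = 0"
| "position (x # l) k = (if x = k then 0 else Suc (position l k))"

definition quiver_rows :: "bool \<Rightarrow> int list list" where
  "quiver_rows t =
    (if t then
      [[0, 1, - 1, 1, - 1, 1, - 1],
       [- 1, 0, 2, 0, 0, 0, 0],
       [1, - 2, 0, 0, 0, 0, 0],
       [- 1, 0, 0, 0, 2, 0, 0],
       [1, 0, 0, - 2, 0, 0, 0],
       [- 1, 0, 0, 0, 0, 0, 2],
       [1, 0, 0, 0, 0, - 2, 0]]
    else
      [[0, - 1, 1, - 1, 1, - 1, 1],
       [1, 0, 1, 0, - 1, 0, - 1],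
       [- 1, - 1, 0, 1, 0, 1, 0],
       [1, 0, - 1, 0, 1, 0, - 1],
       [- 1, 1, 0, - 1, 0, 1, 0],
       [1, 0, - 1, 0, - 1, 0, 1],
       [- 1, 1, 0, 1, 0, - 1, 0]])"

text \<open>
  After the mutation at position \<open>p\<close>, position \<open>i\<close> of the new frame carries the label that was at
  position \<open>move t p ! i\<close>. For every \<open>p\<close> there are six possible entries, one for each automorphism
  of the model. The three pairs of a frame are in cyclic order, and the entries are chosen so that the
  new cyclic order does not depend on the names of the pairs and is compatible with all relations
  between mutations. This is why a mutation of \<open>X\<^sub>7\<close> in a pair not only flips that pair but also
  exchanges the other two. The entries for the second and third pair are those for the first one
  conjugated by a rotation of the pairs.
\<close>

definition move :: "bool \<Rightarrow> nat \<Rightarrow> nat list" where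
  "move t p =
    (if t then
      [positions,
       [0, 2, 1, 5, 6, 3, 4], [0, 2, 1, 5, 6, 3, 4],
       [0, 5, 6, 4, 3, 1, 2], [0, 5, 6, 4, 3, 1, 2],
       [0, 3, 4, 1, 2, 6, 5], [0, 3, 4, 1, 2, 6, 5]]
    else
      [positions,
       [2, 0, 1, 6, 3, 4, 5], [1, 2, 0, 4, 5, 6, 3],
       [4, 6, 1, 0, 3, 2, 5], [3, 2, 5, 4, 0, 6, 1],
       [6, 4, 1, 2, 3, 0, 5], [5, 2, 3, 4, 1, 6, 0]]) ! p"

text \<open>
  Both models have the same automorphism group, the symmetric group that permutes the three pairs. It
  consists of the following rotations and reflections.
\<close>

definition rotations :: "nat list list" where
  "rotations = [positions, [0, 3, 4, 5, 6, 1, 2], [0, 5, 6, 1, 2, 3, 4]]"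

definition reflections :: "nat list list" where
  "reflections = [[0, 3, 4, 1, 2, 5, 6], [0, 1, 2, 5, 6, 3, 4], [0, 5, 6, 3, 4, 1, 2]]"

abbreviation symmetries :: "nat list set" where
  "symmetries \<equiv> set rotations \<union> set reflections"

definition framing :: "nat list \<Rightarrow> bool" where
  "framing l \<longleftrightarrow> length l = 7 \<and> distinct l \<and> set l = X7_vertices"

fun step :: "nat letter \<Rightarrow> frame \<Rightarrow> frame" where
  "step (Perm \<sigma>) (t, l) = (t, map \<sigma> l)"
| "step (Mut k) (t, l) = (t \<noteq> (position l k = 0), reindex l (move t (position l k)))"

fun visit :: "nat letter \<Rightarrow> frame \<Rightarrow> (bool \<times> nat) list" where
  "visit (Perm \<sigma>) (t, l) = []"
| "visit (Mut k) (t, l) = [(t, position l k)]"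

definition run :: "nat mutation_sequence \<Rightarrow> frame \<Rightarrow> frame" where
  "run w s = foldr step w s"

lemma run_simps [simp]:
  "run [] s = s" "run (x # w) s = step x (run w s)" "run (u @ v) s = run u (run v s)"
  by (simp_all add: run_def)

fun trace :: "nat mutation_sequence \<Rightarrow> frame \<Rightarrow> (bool \<times> nat) list" where
  "trace [] s = []"
| "trace (x # w) s = visit x (run w s) @ trace w s"

lemma trace_append [simp]: "trace (u @ v) s = trace u (run v s) @ trace v s"
  by (induction u) simp_all

definition reframe :: "frame \<Rightarrow> nat list \<Rightarrow> frame" where
  "reframe s r = (fst s, reindex (snd s) r)"

definition frame_matrix :: "frame \<Rightarrow> nat matrix" where
  "frame_matrix s = (\<lambda>i j. if i \<in> X7_vertices \<and> j \<in> X7_vertices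
     then quiver_rows (fst s) ! position (snd s) i ! position (snd s) j else 0)"

subsection \<open>Lists as relabellings\<close>

lemma mem_positions [simp]: "p \<in> set positions \<longleftrightarrow> p < 7"
  by (auto simp: positions_def)

lemma X7_vertices_eq: "X7_vertices = {..<7}"
  by (auto simp: X7_vertices_def)

lemma X7_vertices_positions: "X7_vertices = set positions"
  by (auto simp: X7_vertices_def positions_def)

lemma framingD:
  assumes "framing l"
  shows "length l = 7" "distinct l" "set l = {..<7}"
  using assms by (simp_all add: framing_def X7_vertices_eq)

lemma framing_positions [simp]: "framing positions"
  by (auto simp: framing_def positions_def X7_vertices_def)

lemma nth_position: "k \<in> set l \<Longrightarrow> l ! position l k = k"
  by (induction l) auto

lemma position_less: "k \<in> set l \<Longrightarrow> position l k < length l"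
  by (induction l) auto

lemma position_nth: "distinct l \<Longrightarrow> p < length l \<Longrightarrow> position l (l ! p) = p"
  by (induction l arbitrary: p) (auto simp: nth_Cons split: nat.splits)

lemma position_map: "inj_on f (set l) \<Longrightarrow> k \<in> set l \<Longrightarrow> position (map f l) (f k) = position l k"
  by (induction l) (auto simp: inj_on_def)

lemma map_reindex: "set r \<subseteq> {..<length l} \<Longrightarrow> map f (reindex l r) = reindex (map f l) r"
  by (auto simp: reindex_def)

lemma reindex_assoc: "set r' \<subseteq> {..<length r} \<Longrightarrow> reindex (reindex l r) r' = reindex l (reindex r r')"
  by (auto simp: reindex_def)

lemma positions_upt: "positions = [0..<7]"
  by (simp add: positions_def upt_rec)

lemma reindex_positions_left [simp]:
  assumes "set r \<subseteq> {..<7}"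
  shows "reindex positions r = r"
  unfolding reindex_def
proof (rule map_idI)
  show "positions ! p = p" if "p \<in> set r" for p
    using that assms by (auto simp: positions_upt)
qed

lemma reindex_positions [simp]: "length l = 7 \<Longrightarrow> reindex l positions = l"
  unfolding reindex_def positions_upt by (metis map_nth)

lemma inj_on_nth_framing: "framing l \<Longrightarrow> inj_on ((!) l) {..<7}"
  using inj_on_nth[of l "{..<7}"] framingD[of l] by simp

lemma framing_reindex:
  assumes "framing l" "framing r"
  shows "framing (reindex l r)"
proof -
  have "set (reindex l r) = (!) l ` {..<7}"
    using framingD[OF assms(2)] by (simp add: reindex_def)
  also have "\<dots> = set l"
    using framingD[OF assms(1)] by (metis lessThan_atLeast0 list.set_map map_nth set_upt)
  finally show ?thesis
    using framingD[OF assms(1)] framingD[OF assms(2)] inj_on_nth_framing[OF assms(1)]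
    by (simp add: framing_def reindex_def distinct_map X7_vertices_eq)
qed

lemma framing_map:
  assumes "framing l" "\<sigma> permutes X7_vertices"
  shows "framing (map \<sigma> l)"
  using assms permutes_image[OF assms(2)] permutes_inj_on[OF assms(2)]
  by (simp add: framing_def distinct_map)

lemma position_less_7: "framing l \<Longrightarrow> k \<in> X7_vertices \<Longrightarrow> position l k < 7"
  using position_less[of k l] by (simp add: framing_def)

lemma position_reindex:
  assumes "framing l" "framing r" "k \<in> X7_vertices"
  shows "position (reindex l r) k = position r (position l k)"
  using position_map[of "(!) l" r "position l k"] nth_position[of k l] assms
    inj_on_nth_framing[OF assms(1)] position_less_7[OF assms(1,3)] framingD[OF assms(2)]
  by (simp add: reindex_def framing_def)

lemma framing_cases:
  assumes "framing l" "k \<in> X7_vertices"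
  obtains p where "p < 7" "k = l ! p" "position l k = p"
proof
  show "position l k < 7" "k = l ! position l k"
    using position_less_7[OF assms] nth_position[of k l] assms by (simp_all add: framing_def)
qed simp

subsection \<open>Symmetries and mutations of the two quivers\<close>

lemma move_framing: "\<forall>t\<in>{True, False}. \<forall>p\<in>set positions. framing (move t p)"
  unfolding framing_def X7_vertices_positions by code_simp

lemma symmetries_framing: "\<forall>r\<in>symmetries. framing r"
  unfolding framing_def X7_vertices_positions by code_simp

text \<open>
  The tables describe mutation correctly: mutating a model at position \<open>p\<close> and then passing to the
  new frame gives the model of the appropriate type.
\<close>

lemma quiver_rows_mutate: "\<forall>t\<in>{True, False}. \<forall>p\<in>set positions. \<forall>a\<in>set positions. \<forall>b\<in>set positions.
   quiver_rows (t \<noteq> (p = 0)) ! position (move t p) a ! position (move t p) b =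
   (if a = p \<or> b = p then - quiver_rows t ! a ! b
      else quiver_rows t ! a ! b + (\<bar>quiver_rows t ! a ! p\<bar> * quiver_rows t ! p ! b +
        quiver_rows t ! a ! p * \<bar>quiver_rows t ! p ! b\<bar>) div 2)"
  by code_simp

lemma quiver_rows_symmetric: "\<forall>t\<in>{True, False}. \<forall>r\<in>symmetries. \<forall>a\<in>set positions. \<forall>b\<in>set positions.
    quiver_rows t ! position r a ! position r b = quiver_rows t ! a ! b"
  by code_simp

subsection \<open>The exchange matrix of a frame\<close>

lemma frame_matrix_nth:
  assumes "framing l" "a < 7" "b < 7"
  shows "frame_matrix (t, l) (l ! a) (l ! b) = quiver_rows t ! a ! b"
proof -
  have "l ! a \<in> X7_vertices" "l ! b \<in> X7_vertices"
    using assms nth_mem[of a l] nth_mem[of b l] by (simp_all add: framing_def)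
  moreover have "position l (l ! a) = a" "position l (l ! b) = b"
    using assms framingD[OF assms(1)] by (simp_all add: position_nth)
  ultimately show ?thesis
    by (simp add: frame_matrix_def)
qed

lemma frame_matrix_base: "frame_matrix (True, positions) = X7"
proof (intro ext)
  fix i j
  have *: "position positions k = k" if "k < 7" for k
    using position_nth[of positions k] that by (simp add: positions_upt)
  show "frame_matrix (True, positions) i j = X7 i j"
    using * by (simp add: frame_matrix_def X7_rows matrix_of_rows_def X7_vertices_eq quiver_rows_def)
qed

lemma frame_matrix_reframe:
  assumes "framing l" "r \<in> symmetries"
  shows "frame_matrix (reframe (t, l) r) = frame_matrix (t, l)"
proof (intro ext)
  fix i j
  have r: "framing r" using assms symmetries_framing by blast
  show "frame_matrix (reframe (t, l) r) i j = frame_matrix (t, l) i j"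
  proof (cases "i \<in> X7_vertices \<and> j \<in> X7_vertices")
    case True
    then have "position l i \<in> set positions" "position l j \<in> set positions"
      using position_less_7[OF assms(1)] by simp_all
    then have "quiver_rows t ! position r (position l i) ! position r (position l j)
        = quiver_rows t ! position l i ! position l j"
      using quiver_rows_symmetric assms(2) by blast
    then show ?thesis
      using True by (simp add: frame_matrix_def reframe_def position_reindex[OF assms(1) r])
  next
    case False
    then show ?thesis by (auto simp: frame_matrix_def)
  qed
qed

lemma framing_step:
  assumes "framing (snd s)" "[x] \<in> mutation_sequences X7_vertices"
  shows "framing (snd (step x s))"
proof -
  obtain t l where s: "s = (t, l)" by fastforce
  show ?thesis
  proof (cases x)
    case (Mut k)
    then have "position l k \<in> set positions"
      using assms position_less_7[of l k] s by simp
    then have "framing (move t (position l k))"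
      using move_framing by blast
    then show ?thesis
      using assms Mut s by (simp add: framing_reindex)
  next
    case (Perm \<sigma>)
    then show ?thesis
      using assms s by (simp add: framing_map)
  qed
qed

lemma frame_matrix_step:
  assumes "framing (snd s)" "[x] \<in> mutation_sequences X7_vertices"
  shows "frame_matrix (step x s) = apply_letter x (frame_matrix s)"
proof -
  obtain t l where s: "s = (t, l)" by fastforce
  then have l: "framing l" using assms by simp
  show ?thesis
  proof (cases x)
    case (Mut k)
    then have k: "k \<in> X7_vertices" using assms by simp
    define p where "p = position l k"
    have p: "p \<in> set positions"
      using position_less_7[OF l k] by (simp add: p_def)
    then have m: "framing (move t p)" using move_framing by blast
    show ?thesis
    proof (intro ext)
      fix i j
      show "frame_matrix (step x s) i j = apply_letter x (frame_matrix s) i j"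
      proof (cases "i \<in> X7_vertices \<and> j \<in> X7_vertices")
        case True
        define a b where "a = position l i" and "b = position l j"
        have "a \<in> set positions" "b \<in> set positions"
          using True position_less_7[OF l] by (simp_all add: a_def b_def)
        note check = quiver_rows_mutate[rule_format, of t p a b, OF _ p this]
        have "h = k \<longleftrightarrow> position l h = p" if "h \<in> X7_vertices" for h
          using nth_position[of _ l] that k l unfolding p_def framing_def by metis
        then have "i = k \<longleftrightarrow> a = p" "j = k \<longleftrightarrow> b = p"
          using True by (simp_all add: a_def b_def)
        moreover have "frame_matrix (step x s) i j
            = quiver_rows (t \<noteq> (p = 0)) ! position (move t p) a ! position (move t p) b"
          using True m by (simp add: Mut s frame_matrix_def position_reindex[OF l] a_def b_def p_def)
        moreover have "frame_matrix s i j = quiver_rows t ! a ! b"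
          "frame_matrix s i k = quiver_rows t ! a ! p" "frame_matrix s k j = quiver_rows t ! p ! b"
          using True k by (simp_all add: s frame_matrix_def a_def b_def p_def)
        ultimately show ?thesis
          using check by (simp add: Mut mutate_def)
      next
        case False
        then show ?thesis
          by (auto simp: Mut s frame_matrix_def mutate_def)
      qed
    qed
  next
    case (Perm \<sigma>)
    then have \<sigma>: "\<sigma> permutes X7_vertices" using assms by simp
    have "position (map \<sigma> l) i = position l (inv_into UNIV \<sigma> i)" if "i \<in> X7_vertices" for i
      using position_map[of \<sigma> l "inv_into UNIV \<sigma> i"] that l \<sigma> permutes_inj_on[OF \<sigma>]
        permutes_in_image[OF permutes_inv[OF \<sigma>], of i]
      by (simp add: framing_def permutes_inverses)
    moreover have "inv_into UNIV \<sigma> i \<in> X7_vertices \<longleftrightarrow> i \<in> X7_vertices" for i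
      using permutes_in_image[OF permutes_inv[OF \<sigma>]] .
    ultimately show ?thesis
      by (auto simp: Perm s frame_matrix_def permute_matrix_def fun_eq_iff)
  qed
qed

lemma run_framing:
  assumes "framing (snd s)" "w \<in> mutation_sequences X7_vertices"
  shows "framing (snd (run w s))" "frame_matrix (run w s) = apply_sequence w (frame_matrix s)"
proof -
  have "framing (snd (run w s)) \<and> frame_matrix (run w s) = apply_sequence w (frame_matrix s)"
    using assms(2)
  proof (induction w)
    case (Cons x w)
    then have "[x] \<in> mutation_sequences X7_vertices" "w \<in> mutation_sequences X7_vertices"
      by (auto simp: mutation_sequences_def)
    with Cons show ?case
      by (simp add: framing_step frame_matrix_step)
  qed (simp add: assms)
  then show "framing (snd (run w s))" "frame_matrix (run w s) = apply_sequence w (frame_matrix s)"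
    by blast+
qed

section \<open>Weights and frames modulo rotation\<close>

text \<open>
  In the abelianization a mutation of the second model at the first vertex of a pair becomes the class
  of \<open>\<psi>\<^sub>1\<close>, and the weight of a mutation is its exponent with respect to this class. The two vertices of
  a pair have opposite weights because \<open>\<mu>\<^sub>k \<mu>\<^sub>k = 1\<close>; the factor 2 for \<open>X\<^sub>7\<close> comes from its pentagons,
  which consist of mutations at the centre, two mutations of the second model and one of \<open>X\<^sub>7\<close>. A
  pentagon of the second model between two different pairs has total weight \<open>\<plusminus> 5\<close>, so that only the
  weight modulo 5 is an invariant.
\<close>

fun weight :: "bool \<times> nat \<Rightarrow> int" where
  "weight (t, p) = (if p = 0 then 0 else if odd p then 1 else - 1) * (if t then 2 else 1)"

definition total_weight :: "nat mutation_sequence \<Rightarrow> frame \<Rightarrow> int" where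
  "total_weight w s = sum_list (map weight (trace w s))"

text \<open>
  Relations preserve frames only up to a rotation of the three pairs, that is, they preserve the
  cyclic order of the pairs.
\<close>

definition same_frame :: "frame \<Rightarrow> frame \<Rightarrow> bool" where
  "same_frame s s' \<longleftrightarrow> (\<exists>r\<in>set rotations. s' = reframe s r)"

lemma total_weight_simps [simp]:
  "total_weight [] s = 0"
  "total_weight (u @ v) s = total_weight u (run v s) + total_weight v s"
  by (simp_all add: total_weight_def)

lemma total_weight_Cons:
  "total_weight (x # w) s = total_weight [x] (run w s) + total_weight w s"
  by (simp add: total_weight_def)

lemma reindex_symmetries: "\<forall>r\<in>symmetries. \<forall>r'\<in>symmetries.
    reindex r r' \<in> symmetries \<and>
    (reindex r r' \<in> set rotations \<longleftrightarrow> (r \<in> set rotations \<longleftrightarrow> r' \<in> set rotations))"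
  by code_simp

lemma rotation_inverse: "\<forall>r\<in>set rotations. \<exists>r'\<in>set rotations. reindex r r' = positions"
  by code_simp

lemma reframe_reframe:
  assumes "framing r" "framing r'"
  shows "reframe (reframe s r) r' = reframe s (reindex r r')"
  using framingD[OF assms(1)] framingD[OF assms(2)] by (simp add: reframe_def reindex_assoc)

lemma reframe_positions: "framing (snd s) \<Longrightarrow> reframe s positions = s"
  by (simp add: reframe_def framingD)

lemma rotation_framing: "r \<in> set rotations \<Longrightarrow> framing r"
  using symmetries_framing by blast

lemma same_frame_refl: "framing (snd s) \<Longrightarrow> same_frame s s"
  unfolding same_frame_def using reframe_positions[of s]
  by (intro bexI[of _ positions]) (simp_all add: rotations_def)

lemma same_frame_trans:
  assumes "same_frame s s'" "same_frame s' s''"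
  shows "same_frame s s''"
proof -
  obtain r r' where r: "r \<in> set rotations" "r' \<in> set rotations" "s' = reframe s r" "s'' = reframe s' r'"
    using assms unfolding same_frame_def by blast
  then have "s'' = reframe s (reindex r r')"
    by (simp add: reframe_reframe rotation_framing)
  moreover have "reindex r r' \<in> set rotations"
    using r reindex_symmetries by blast
  ultimately show ?thesis
    unfolding same_frame_def by blast
qed

lemma same_frame_sym:
  assumes "same_frame s s'" "framing (snd s)"
  shows "same_frame s' s"
proof -
  obtain r where r: "r \<in> set rotations" "s' = reframe s r"
    using assms unfolding same_frame_def by blast
  then obtain r' where r': "r' \<in> set rotations" "reindex r r' = positions"
    using rotation_inverse by blast
  then have "reframe s' r' = s"
    using r reframe_positions[OF assms(2)] by (simp add: reframe_reframe rotation_framing)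
  then show ?thesis
    using r' unfolding same_frame_def by metis
qed

lemma framing_reframe: "framing (snd s) \<Longrightarrow> framing r \<Longrightarrow> framing (snd (reframe s r))"
  by (simp add: reframe_def framing_reindex)

lemma same_frame_matrix: 
  assumes "same_frame s s'" "framing (snd s)" 
  shows "frame_matrix s' = frame_matrix s"
proof -
  obtain r where "r \<in> symmetries" "s' = reframe s r"
    using assms(1) unfolding same_frame_def by blast
  then show ?thesis
    using frame_matrix_reframe[of "snd s" r "fst s"] assms(2) by simp
qed

text \<open>
  A symmetry of the model commutes with the moves up to a rotation. For reflections this expresses
  that the rule for the new cyclic order is the same for both cyclic orders.
\<close>

lemma move_symmetric:
  "\<forall>t\<in>{True, False}. \<forall>p\<in>set positions. \<forall>r\<in>symmetries.
    (position r p = 0 \<longleftrightarrow> p = 0) \<and> weight (t, position r p) = weight (t, p) \<and>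
    (\<exists>r'\<in>set rotations. reindex r (move t (position r p)) = reindex (reindex (move t p) r) r')"
  by code_simp

lemma step_reframe:
  assumes s: "framing (snd s)" and x: "[x] \<in> mutation_sequences X7_vertices" and r: "r \<in> symmetries"
  shows "same_frame (reframe (step x s) r) (step x (reframe s r))"
    and "total_weight [x] (reframe s r) = total_weight [x] s"
proof -
  obtain t l where tl: "s = (t, l)" by fastforce
  then have l: "framing l" using s by simp
  have fr: "framing r" using r symmetries_framing by blast
  have "same_frame (reframe (step x s) r) (step x (reframe s r)) \<and>
    total_weight [x] (reframe s r) = total_weight [x] s"
  proof (cases x)
    case (Mut k)
    then have k: "k \<in> X7_vertices" using x by simp
    define p where "p = position l k"
    have p: "p \<in> set positions"
      using position_less_7[OF l k] by (simp add: p_def)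
    have t: "t \<in> {True, False}" by simp
    have p': "position (reindex l r) k = position r p"
      using position_reindex[OF l fr k] by (simp add: p_def)
    note check = move_symmetric[rule_format, OF t p r]
    note c = check[THEN conjunct1] check[THEN conjunct2, THEN conjunct1]
    obtain r' where r': "r' \<in> set rotations"
        "reindex r (move t (position r p)) = reindex (reindex (move t p) r) r'"
      using check[THEN conjunct2, THEN conjunct2] ..
    have m: "framing (move t p)"
      using move_framing t p by blast
    have "position r p \<in> set positions"
      using position_less_7[OF fr] p by (simp add: X7_vertices_eq)
    then have m': "framing (move t (position r p))"
      using move_framing t by blast
    have "step x (reframe s r) = (t \<noteq> (p = 0), reindex (reindex l r) (move t (position r p)))"
      using c p' by (simp add: Mut tl reframe_def)
    also have "\<dots> = (t \<noteq> (p = 0), reindex l (reindex (reindex (move t p) r) r'))"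
      using reindex_assoc[of "move t (position r p)" r l] framingD[OF m'] framingD[OF fr] r' by simp
    also have "reindex l (reindex (reindex (move t p) r) r')
        = reindex (reindex (reindex l (move t p)) r) r'"
      using framingD[OF m] framingD[OF fr] framingD[OF rotation_framing[OF r'(1)]]
        framingD[OF framing_reindex[OF m fr]]
      by (simp add: reindex_assoc)
    also have "(t \<noteq> (p = 0), \<dots>) = reframe (reframe (step x s) r) r'"
      by (simp add: Mut tl reframe_def p_def)
    finally have "same_frame (reframe (step x s) r) (step x (reframe s r))"
      using r' unfolding same_frame_def by blast
    moreover have "total_weight [x] (reframe s r) = total_weight [x] s"
      using c p' by (simp add: total_weight_def Mut tl reframe_def p_def del: weight.simps)
    ultimately show ?thesis ..
  next
    case (Perm \<sigma>)
    have "step x (reframe s r) = reframe (step x s) r"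
      using framingD[OF l] framingD[OF fr] by (simp add: Perm tl reframe_def map_reindex)
    moreover have "framing (snd (reframe (step x s) r))"
      by (intro framing_reframe framing_step s x fr)
    ultimately show ?thesis
      by (simp add: same_frame_refl) (simp add: total_weight_def Perm tl reframe_def)
  qed
  then show "same_frame (reframe (step x s) r) (step x (reframe s r))"
    and "total_weight [x] (reframe s r) = total_weight [x] s"
    by blast+
qed

lemma mutation_sequences_Cons:
  "x # w \<in> mutation_sequences I \<longleftrightarrow> [x] \<in> mutation_sequences I \<and> w \<in> mutation_sequences I"
  by (simp add: mutation_sequences_def)

lemma step_same_frame:
  assumes "framing (snd s)" "same_frame s s'" "[x] \<in> mutation_sequences X7_vertices"
  shows "same_frame (step x s) (step x s')" "total_weight [x] s' = total_weight [x] s"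
proof -
  obtain r where r: "r \<in> set rotations" "s' = reframe s r"
    using assms unfolding same_frame_def by blast
  have "same_frame (step x s) (reframe (step x s) r)"
    using r unfolding same_frame_def by blast
  with r show "same_frame (step x s) (step x s')" "total_weight [x] s' = total_weight [x] s"
    using step_reframe[OF assms(1,3), of r] same_frame_trans by blast+
qed

lemma run_same_frame:
  assumes "framing (snd s)" "same_frame s s'" "w \<in> mutation_sequences X7_vertices"
  shows "same_frame (run w s) (run w s')" "total_weight w s' = total_weight w s"
proof -
  have "same_frame (run w s) (run w s') \<and> total_weight w s' = total_weight w s"
    using assms(3)
  proof (induction w)
    case (Cons x w)
    then have w: "[x] \<in> mutation_sequences X7_vertices" "w \<in> mutation_sequences X7_vertices"
      using mutation_sequences_Cons by blast+
    then show ?case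
      using Cons.IH step_same_frame[OF run_framing(1)[OF assms(1) w(2)] _ w(1)]
      by (simp add: total_weight_Cons[of x w])
  qed (simp add: assms)
  then show "same_frame (run w s) (run w s')" "total_weight w s' = total_weight w s"
    by blast+
qed

lemma run_reframe:
  assumes s: "framing (snd s)" and w: "w \<in> mutation_sequences X7_vertices" and r: "r \<in> symmetries"
  shows "same_frame (reframe (run w s) r) (run w (reframe s r))"
    and "total_weight w (reframe s r) = total_weight w s"
proof -
  have fr: "framing r" using r symmetries_framing by blast
  have "same_frame (reframe (run w s) r) (run w (reframe s r)) \<and>
      total_weight w (reframe s r) = total_weight w s"
    using w
  proof (induction w)
    case Nil
    then show ?case by (simp add: same_frame_refl framing_reframe s fr)
  next
    case (Cons x w)
    then have w: "[x] \<in> mutation_sequences X7_vertices" "w \<in> mutation_sequences X7_vertices"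
      using mutation_sequences_Cons by blast+
    have f: "framing (snd (run w s))"
      by (intro run_framing s w)
    note IH = Cons.IH[OF w(2)]
    note 1 = step_reframe[OF f w(1) r]
    note 2 = step_same_frame[OF framing_reframe[OF f fr] conjunct1[OF IH] w(1)]
    show ?case
      using same_frame_trans[OF 1(1) 2(1)] 1(2) 2(2) IH by (simp add: total_weight_Cons[of x w])
  qed
  then show "same_frame (reframe (run w s) r) (run w (reframe s r))"
    and "total_weight w (reframe s r) = total_weight w s"
    by blast+
qed

subsection \<open>Invariance under the defining relations\<close>

lemma map_Mut_in_mutation_sequences: "map Mut ks \<in> mutation_sequences I \<longleftrightarrow> set ks \<subseteq> I"
  by (induction ks) simp_all

text \<open>
  The behaviour of a frame does not depend on its labels, which reduces the verification of the
  relations to the two models.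
\<close>

lemma run_at_positions:
  assumes l: "framing l" and "set ks \<subseteq> {..<7}"
  shows "run (map (\<lambda>p. Mut (l ! p)) ks) (t, l)
      = (fst (run (map Mut ks) (t, positions)), reindex l (snd (run (map Mut ks) (t, positions))))"
    and "trace (map (\<lambda>p. Mut (l ! p)) ks) (t, l) = trace (map Mut ks) (t, positions)"
proof -
  have "run (map (\<lambda>p. Mut (l ! p)) ks) (t, l)
      = (fst (run (map Mut ks) (t, positions)), reindex l (snd (run (map Mut ks) (t, positions)))) \<and>
    trace (map (\<lambda>p. Mut (l ! p)) ks) (t, l) = trace (map Mut ks) (t, positions)"
    using assms(2)
  proof (induction ks)
    case Nil
    then show ?case using framingD[OF l] by simp
  next
    case (Cons p ks)
    obtain t' m where s: "run (map Mut ks) (t, positions) = (t', m)" by fastforce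
    have ks: "map Mut ks \<in> mutation_sequences X7_vertices"
      using Cons.prems by (simp add: map_Mut_in_mutation_sequences X7_vertices_eq)
    have m: "framing m"
      using run_framing(1)[OF _ ks, of "(t, positions)"] s by simp
    have p: "p < 7" "l ! p \<in> X7_vertices"
      using Cons.prems nth_mem[of p l] l by (auto simp: framing_def)
    have pos: "position (reindex l m) (l ! p) = position m p"
      using position_reindex[OF l m p(2)] position_nth[of l p] p(1) framingD[OF l] by simp
    have "position m p \<in> set positions"
      using position_less_7[OF m] p by (simp add: X7_vertices_eq)
    then have "framing (move t' (position m p))"
      using move_framing by blast
    then show ?case
      using Cons s pos framingD[OF m] by (simp add: reindex_assoc framingD)
  qed
  then show "run (map (\<lambda>p. Mut (l ! p)) ks) (t, l)
      = (fst (run (map Mut ks) (t, positions)), reindex l (snd (run (map Mut ks) (t, positions))))"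
    and "trace (map (\<lambda>p. Mut (l ! p)) ks) (t, l) = trace (map Mut ks) (t, positions)"
    by blast+
qed

definition equal_up_to :: "nat mutation_sequence \<Rightarrow> nat mutation_sequence \<Rightarrow> frame \<Rightarrow> bool" where
  "equal_up_to a b s \<longleftrightarrow> same_frame (run a s) (run b s) \<and> total_weight a s mod 5 = total_weight b s mod 5"

lemma involution_at_positions: "\<forall>t\<in>{True, False}. \<forall>p\<in>set positions. equal_up_to [Mut p, Mut p] [] (t, positions)"
  by code_simp

lemma square_at_positions: "\<forall>t\<in>{True, False}. \<forall>p\<in>set positions. 
   \<forall>q\<in>set (filter (\<lambda>q. quiver_rows t ! p ! q = 0) positions). equal_up_to [Mut p, Mut q] [Mut q, Mut p] (t, positions)"
  by code_simp

text \<open>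
  This is the decisive verification. Once mutations at the centre keep the frame, the pentagons leave
  no other choice for the cyclic order after the remaining mutations, and they force the weights to be
  taken modulo 5.
\<close>

lemma pentagon_at_positions: "\<forall>t\<in>{True, False}. \<forall>p\<in>set positions. 
   \<forall>q\<in>set (filter (\<lambda>q. quiver_rows t ! p ! q = 1 \<or> quiver_rows t ! p ! q = - 1) positions).
   equal_up_to [Mut p, Mut q, Mut p, Mut q, Mut p] [Perm (transpose p q)] (t, positions)"
  by code_simp

lemma equal_up_to_refl: "framing (snd (run a s)) \<Longrightarrow> equal_up_to a a s"
  by (simp add: equal_up_to_def same_frame_refl)

lemma relabel_same_frame:
  assumes "same_frame (t, m) (t', m')" "framing m"
  shows "same_frame (t, reindex l m) (t', reindex l m')"
proof -
  obtain r where r: "r \<in> set rotations" "t' = t" "m' = reindex m r"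
    using assms(1) by (auto simp: same_frame_def reframe_def)
  then have "(t', reindex l m') = reframe (t, reindex l m) r"
    using framingD[OF rotation_framing[OF r(1)]] framingD[OF assms(2)]
    by (simp add: reframe_def reindex_assoc)
  then show ?thesis
    using r(1) unfolding same_frame_def by blast
qed

lemma equal_up_to_at_positions:
  assumes l: "framing l" and ps: "set ps \<subseteq> {..<7}" "set qs \<subseteq> {..<7}"
    and eq: "equal_up_to (map Mut ps) (map Mut qs) (t, positions)"
  shows "equal_up_to (map (\<lambda>p. Mut (l ! p)) ps) (map (\<lambda>p. Mut (l ! p)) qs) (t, l)"
proof -
  have "framing (snd (run (map Mut ps) (t, positions)))"
    using ps by (intro run_framing) (simp_all add: map_Mut_in_mutation_sequences X7_vertices_eq)
  then show ?thesis
    using eq relabel_same_frame[of "fst (run (map Mut ps) (t, positions))" "snd (run (map Mut ps) (t, positions))"]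
    by (simp add: equal_up_to_def total_weight_def run_at_positions[OF l] ps)
qed

text \<open>
  The relations between permutations and the conjugation relation hold exactly, because frames are
  relabelled by composition; the others are transported from the two models.
\<close>

lemma basic_relation_equal_up_to:
  assumes rel: "basic_relation X7_vertices (frame_matrix s) a b" and s: "framing (snd s)"
  shows "equal_up_to a b s"
proof -
  obtain t l where tl: "s = (t, l)" by fastforce
  then have l: "framing l" using s by simp
  have t: "t \<in> {True, False}" by simp
  have pos: "\<exists>p\<in>set positions. k = l ! p" if "k \<in> X7_vertices" for k
    using framing_cases[OF l that] by (metis mem_positions)
  from rel show ?thesis
  proof cases
    case (involution k)
    then obtain p where p: "p \<in> set positions" "k = l ! p"
      using pos by blast
    have "equal_up_to (map Mut [p, p]) (map Mut []) (t, positions)"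
      using involution_at_positions[rule_format, OF t p(1)] by simp
    then show ?thesis
      using equal_up_to_at_positions[OF l, of "[p, p]" "[]" t] p by (simp add: involution tl)
  next
    case (conjugation \<sigma> k)
    have \<sigma>: "inv_into UNIV \<sigma> permutes X7_vertices"
      using conjugation by (simp add: permutes_inv)
    have "position (map (inv_into UNIV \<sigma>) l) k = position l (\<sigma> k)"
      using position_map[of "inv_into UNIV \<sigma>" l "\<sigma> k"] conjugation l permutes_inj_on[OF \<sigma>]
      by (simp add: framing_def permutes_in_image permutes_inverses)
    moreover have "position l (\<sigma> k) \<in> set positions"
      using position_less_7[OF l] conjugation by (simp add: permutes_in_image)
    then have m: "framing (move t (position l (\<sigma> k)))"
      using move_framing by blast
    then have "map \<sigma> (reindex (map (inv_into UNIV \<sigma>) l) (move t (position l (\<sigma> k))))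
        = reindex l (move t (position l (\<sigma> k)))"
      using framingD[OF l] framingD[OF m] permutes_inverses(1)[OF conjugation(3)]
      by (simp add: map_reindex comp_def)
    ultimately have "run a s = run b s" "total_weight a s = total_weight b s"
      by (simp_all add: conjugation(1,2) tl total_weight_def)
    moreover have "framing (snd (run b s))"
      using conjugation s by (intro run_framing) (simp_all add: permutes_in_image)
    ultimately show ?thesis
      by (simp add: equal_up_to_def same_frame_refl)
  next
    case (square i j)
    then obtain p q where p: "p \<in> set positions" "i = l ! p" and q: "q \<in> set positions" "j = l ! q"
      using pos by blast
    then have "quiver_rows t ! p ! q = 0"
      using square frame_matrix_nth[OF l, of p q t] by (simp add: tl)
    then have "equal_up_to (map Mut [p, q]) (map Mut [q, p]) (t, positions)"
      using square_at_positions[rule_format, OF t p(1), of q] q(1) by simp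
    then show ?thesis
      using equal_up_to_at_positions[OF l, of "[p, q]" "[q, p]" t] p q by (simp add: square tl)
  next
    case (pentagon i j)
    then obtain p q where p: "p \<in> set positions" "i = l ! p" and q: "q \<in> set positions" "j = l ! q"
      using pos by blast
    let ?w = "[p, q, p, q, p]"
    have "quiver_rows t ! p ! q = 1 \<or> quiver_rows t ! p ! q = - 1"
      using pentagon p q frame_matrix_nth[OF l, of p q t] by (simp add: tl)
    then have eq: "equal_up_to (map Mut ?w) [Perm (transpose p q)] (t, positions)"
      using pentagon_at_positions[rule_format, OF t p(1), of q] q(1) by simp
    have "transpose (l ! p) (l ! q) (l ! k) = l ! transpose p q k" if "k < 7" for k
      using that p q l framingD[OF l] by (auto simp: transpose_def nth_eq_iff_index_eq)
    then have "map (transpose (l ! p) (l ! q)) (reindex l positions)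
        = reindex l (map (transpose p q) positions)"
      by (simp add: reindex_def)
    then have b: "map (transpose (l ! p) (l ! q)) l = reindex l (map (transpose p q) positions)"
      using framingD[OF l] by simp
    have w: "set ?w \<subseteq> {..<7}"
      using p q by simp
    then have "framing (snd (run (map Mut ?w) (t, positions)))"
      by (intro run_framing) (simp_all only: map_Mut_in_mutation_sequences X7_vertices_eq snd_conv framing_positions)
    then have "same_frame (run (map (\<lambda>p. Mut (l ! p)) ?w) (t, l)) (run b s)"
      using relabel_same_frame[of "fst (run (map Mut ?w) (t, positions))"
          "snd (run (map Mut ?w) (t, positions))" _ _ l] eq b
      unfolding run_at_positions[OF l w] by (simp add: equal_up_to_def pentagon tl p q del: list.map step.simps(2))
    moreover have "total_weight (map (\<lambda>p. Mut (l ! p)) ?w) (t, l) = total_weight (map Mut ?w) (t, positions)"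
      unfolding total_weight_def run_at_positions[OF l w] ..
    moreover have "a = map (\<lambda>p. Mut (l ! p)) ?w"
      by (simp add: pentagon p q)
    moreover have "total_weight b s = total_weight [Perm (transpose p q)] (t, positions)"
      by (simp add: pentagon(2) tl total_weight_def)
    ultimately show ?thesis
      using eq unfolding equal_up_to_def tl by metis
  next
    case (perm_comp \<sigma> \<tau>)
    moreover have "framing (snd (run b s))"
      using perm_comp s by (intro run_framing) (simp_all add: permutes_compose)
    ultimately show ?thesis
      by (simp add: equal_up_to_def tl total_weight_def same_frame_refl)
  next
    case perm_id
    then show ?thesis
      using s by (simp add: equal_up_to_def tl total_weight_def same_frame_refl)
  qed
qed

definition base_frame :: frame where
  "base_frame = (True, positions)"

lemma framing_base_frame [simp]: "framing (snd base_frame)"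
  by (simp add: base_frame_def)

lemma frame_matrix_base_frame [simp]: "frame_matrix base_frame = X7"
  by (simp add: base_frame_def frame_matrix_base)

text \<open>
  A relation may be applied in the middle of a sequence: the part to its right produces the frame at
  which it is applied, and the part to its left depends only on the frame modulo rotations.
\<close>

lemma path_equiv_equal_up_to:
  assumes "path_equiv X7_vertices X7 w w'" "w \<in> mutation_sequences X7_vertices"
  shows "equal_up_to w w' base_frame"
proof -
  have "w' \<in> mutation_sequences X7_vertices \<and> equal_up_to w w' base_frame"
    using assms(1) unfolding path_equiv_def
  proof (induction rule: equivclp_induct)
    case base
    then show ?case using assms(2) run_framing(1)[of base_frame w] by (simp add: equal_up_to_refl)
  next
    case (step y z)
    have move: "equal_up_to y z base_frame" if yz: "path_move X7_vertices X7 y z" for y z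
    proof -
      from yz obtain u v a b where eq: "y = u @ a @ v" "z = u @ b @ v"
        and rel: "basic_relation X7_vertices (apply_sequence v X7) a b"
        and mem: "u \<in> mutation_sequences X7_vertices" "a \<in> mutation_sequences X7_vertices"
          "v \<in> mutation_sequences X7_vertices"
        unfolding path_move_def by auto
      have f: "framing (snd (run v base_frame))" "framing (snd (run a (run v base_frame)))"
        using mem by (simp_all add: run_framing)
      have "frame_matrix (run v base_frame) = apply_sequence v X7"
        using run_framing(2)[of base_frame v] mem by simp
      then have "equal_up_to a b (run v base_frame)"
        using basic_relation_equal_up_to[OF _ f(1)] rel by simp
      then show ?thesis
        using run_same_frame[OF f(2) _ mem(1)] unfolding equal_up_to_def eq
        by simp (metis mod_add_cong mod_add_left_eq mod_add_right_eq)
    qed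
    have "y \<in> mutation_sequences X7_vertices" "z \<in> mutation_sequences X7_vertices"
      using step by (auto simp: path_move_def)
    then have f: "framing (snd (run y base_frame))" "framing (snd (run z base_frame))"
      by (simp_all add: run_framing)
    have "equal_up_to y z base_frame"
      using step(2) move f same_frame_sym unfolding equal_up_to_def by metis
    then show ?case
      using step \<open>z \<in> mutation_sequences X7_vertices\<close> same_frame_trans
      unfolding equal_up_to_def by metis
  qed
  then show ?thesis ..
qed

subsection \<open>The invariant of a loop\<close>

lemma no_double_arrow: "\<forall>a\<in>set positions. \<forall>b\<in>set positions. quiver_rows False ! a ! b \<noteq> 2"
  by code_simp

lemma double_arrow: "\<forall>a\<in>set positions. \<forall>b\<in>set positions.
    quiver_rows True ! a ! b = 2 \<longrightarrow> (a, b) \<in> set [(1, 2), (3, 4), (5, 6)]"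
  by code_simp

text \<open>
  A frame with matrix \<open>X\<^sub>7\<close> is an automorphism of \<open>X\<^sub>7\<close>: the double arrows of \<open>X\<^sub>7\<close> are \<open>1 \<rightarrow> 2\<close>,
  \<open>3 \<rightarrow> 4\<close>, \<open>5 \<rightarrow> 6\<close>, so the pairs are permuted and the centre is fixed; the second model has no
  double arrows.
\<close>

lemma symmetry_if_frame_matrix_X7:
  assumes l: "framing l" and M: "frame_matrix (t, l) = X7"
  shows "t" "l \<in> symmetries"
proof -
  have X: "X7 i j = quiver_rows True ! i ! j" if "i < 7" "j < 7" for i j
    using that by (simp add: X7_rows matrix_of_rows_def quiver_rows_def)
  have less: "l ! a < 7" if "a < 7" for a
    using that nth_mem[of a l] framingD[OF l] by auto
  have row: "quiver_rows True ! (l ! a) ! (l ! b) = quiver_rows t ! a ! b" if "a < 7" "b < 7" for a b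
    using that frame_matrix_nth[OF l that, of t] M X less by simp
  show t
  proof (rule ccontr)
    assume "\<not> t"
    have "\<exists>a. a < 7 \<and> l ! a = 1" "\<exists>b. b < 7 \<and> l ! b = 2"
      using framing_cases[OF l, of 1] framing_cases[OF l, of 2] by (metis X7_vertices_eq lessThan_iff numeral_less_iff one_less_numeral_iff semiring_norm)+
    then obtain a b where "a < 7" "l ! a = 1" "b < 7" "l ! b = 2"
      by blast
    then show False
      using row[of a b] no_double_arrow[rule_format, of a b] \<open>\<not> t\<close> by (simp add: quiver_rows_def)
  qed
  then have row: "quiver_rows True ! (l ! a) ! (l ! b) = quiver_rows True ! a ! b" if "a < 7" "b < 7" for a b
    using row that by simp
  have pair: "(l ! a, l ! b) \<in> set [(1, 2), (3, 4), (5, 6)]" if "a < 7" "b < 7" "quiver_rows True ! a ! b = 2" for a b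
    using double_arrow[rule_format, of "l ! a" "l ! b"] that less row by simp
  have pairs: "(l ! 1, l ! 2) \<in> set [(1, 2), (3, 4), (5, 6)]" "(l ! 3, l ! 4) \<in> set [(1, 2), (3, 4), (5, 6)]"
    "(l ! 5, l ! 6) \<in> set [(1, 2), (3, 4), (5, 6)]"
    by (rule pair; simp add: quiver_rows_def)+
  have "map ((!) l) positions = l"
    using reindex_positions framingD[OF l] by (simp add: reindex_def)
  then have list: "l = [l ! 0, l ! 1, l ! 2, l ! 3, l ! 4, l ! 5, l ! 6]"
    by (simp add: positions_def)
  have neq: "l ! a = l ! b \<longleftrightarrow> a = b" if "a < 7" "b < 7" for a b
    using that framingD[OF l] by (simp add: nth_eq_iff_index_eq)
  have dist: "l ! 1 \<noteq> l ! 3" "l ! 1 \<noteq> l ! 5" "l ! 3 \<noteq> l ! 5"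
    by (simp_all add: neq)
  have "l ! 0 \<notin> {l ! 1, l ! 2, l ! 3, l ! 4, l ! 5, l ! 6}"
    by (simp add: neq)
  moreover have "{a, b, c, d, e, f} = {1, 2, 3, 4, 5, 6} \<and> [0, a, b, c, d, e, f] \<in> symmetries"
    if "(a, b) \<in> set [(1, 2), (3, 4), (5, 6)]" "(c, d) \<in> set [(1, 2), (3, 4), (5, 6)]"
      "(e, f) \<in> set [(1, 2), (3, 4), (5, 6)]" "a \<noteq> c" "a \<noteq> e" "c \<noteq> e"
    for a b c d e f :: nat
    using that by (auto simp: rotations_def reflections_def positions_def)
  note this[OF pairs dist]
  moreover have "n = 0" if "n \<notin> {1, 2, 3, 4, 5, 6}" "n < 7" for n :: nat
    using that by auto
  note this[of "l ! 0", OF _ less]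
  ultimately show "l \<in> symmetries"
    using list by (metis zero_less_numeral)
qed

definition final_frame :: "nat mutation_sequence \<Rightarrow> nat list" where
  "final_frame w = snd (run w base_frame)"

text \<open>
  The final frame of a loop is an automorphism of \<open>X\<^sub>7\<close>, hence a permutation of the three pairs; the
  second component is the parity of this permutation.
\<close>

definition invariant :: "nat mutation_sequence \<Rightarrow> int \<times> int" where
  "invariant w = (total_weight w base_frame mod 5,
     if final_frame w \<in> set rotations then 0 else 1)"

lemma run_loop:
  assumes "w \<in> mutation_loops X7_vertices X7"
  shows "run w base_frame = (True, final_frame w)" "final_frame w \<in> symmetries"
proof -
  have w: "w \<in> mutation_sequences X7_vertices" "apply_sequence w X7 = X7"
    using assms by (simp_all add: mutation_loops_def)
  obtain t l where tl: "run w base_frame = (t, l)" by fastforce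
  have "framing l" "frame_matrix (t, l) = X7"
    using run_framing[of base_frame w] w tl by simp_all
  from symmetry_if_frame_matrix_X7[OF this] tl
  show "run w base_frame = (True, final_frame w)" "final_frame w \<in> symmetries"
    by (simp_all add: final_frame_def)
qed

lemma reindex_in_rotations_iff:
  assumes "r \<in> symmetries" "r' \<in> symmetries"
  shows "reindex r r' \<in> set rotations \<longleftrightarrow> (r \<in> set rotations \<longleftrightarrow> r' \<in> set rotations)"
    and "reindex r r' \<in> symmetries"
  using reindex_symmetries assms by blast+

lemma rotation_symmetry: "r \<in> set rotations \<Longrightarrow> r \<in> symmetries"
  by blast

text \<open>
  After the loop \<open>v\<close> the sequence \<open>u\<close> starts from a frame that differs from the initial one by a
  symmetry. The symmetry does not affect the weight of \<open>u\<close>, and it multiplies the final frame from the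
  right, up to a rotation.
\<close>

lemma invariant_append:
  assumes "u \<in> mutation_loops X7_vertices X7" "v \<in> mutation_loops X7_vertices X7"
  shows "invariant (u @ v) = invariant u \<otimes>\<^bsub>integer_mod_group 5 \<times>\<times> integer_mod_group 2\<^esub> invariant v"
proof -
  note u = run_loop[OF assms(1)] and v = run_loop[OF assms(2)]
  have mem: "u \<in> mutation_sequences X7_vertices"
    using assms by (simp add: mutation_loops_def)
  have fv: "framing (final_frame v)"
    using symmetries_framing v(2) by blast
  have "(True, final_frame v) = reframe base_frame (final_frame v)"
    using framingD[OF fv] by (simp add: reframe_def base_frame_def)
  then have run: "run (u @ v) base_frame = run u (reframe base_frame (final_frame v))"
    and weight: "total_weight (u @ v) base_frame
      = total_weight u (reframe base_frame (final_frame v)) + total_weight v base_frame"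
    using v(1) by simp_all
  note R = run_reframe[OF framing_base_frame mem v(2)]
  obtain r where r: "r \<in> set rotations"
    "run (u @ v) base_frame = reframe (reframe (run u base_frame) (final_frame v)) r"
    using R(1) run unfolding same_frame_def by metis
  then have "final_frame (u @ v) = reindex (reindex (final_frame u) (final_frame v)) r"
    by (simp add: final_frame_def reframe_def)
  then have "final_frame (u @ v) \<in> set rotations \<longleftrightarrow>
      (final_frame u \<in> set rotations \<longleftrightarrow> final_frame v \<in> set rotations)"
    using reindex_in_rotations_iff[OF u(2) v(2)] r(1) rotation_symmetry[OF r(1)]
      reindex_in_rotations_iff(1)[of "reindex (final_frame u) (final_frame v)" r]
    by simp
  then show ?thesis
    using weight R(2) by (simp add: invariant_def mod_add_eq)
qed

lemma invariant_loop_equiv: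
  assumes "(w, w') \<in> loop_equiv X7_vertices X7"
  shows "invariant w = invariant w'"
proof -
  have w: "w \<in> mutation_loops X7_vertices X7" "w' \<in> mutation_loops X7_vertices X7"
    using assms by (simp_all add: loop_equiv_def)
  have "path_equiv X7_vertices X7 w w'"
    using assms by (simp add: loop_equiv_def elementary_equiv_imp_path_equiv)
  then have eq: "equal_up_to w w' base_frame"
    using w path_equiv_equal_up_to by (simp add: mutation_loops_def)
  then obtain r where r: "r \<in> set rotations" "final_frame w' = reindex (final_frame w) r"
    by (auto simp: equal_up_to_def same_frame_def final_frame_def reframe_def)
  then have "final_frame w' \<in> set rotations \<longleftrightarrow> final_frame w \<in> set rotations"
    using reindex_in_rotations_iff(1)[OF run_loop(2)[OF w(1)] rotation_symmetry[OF r(1)]] by simp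
  then show ?thesis
    using eq by (simp add: invariant_def equal_up_to_def)
qed

lemma invariant_carrier:
  "invariant w \<in> carrier (integer_mod_group 5 \<times>\<times> integer_mod_group 2)"
  by (simp add: invariant_def carrier_integer_mod_group)

lemma mem_X7_vertices [simp]: "k \<in> X7_vertices \<longleftrightarrow> k < 7"
  by (simp add: X7_vertices_eq)

section \<open>Canonical paths\<close>

definition frame_perm :: "nat list \<Rightarrow> nat \<Rightarrow> nat" where
  "frame_perm l = (\<lambda>i. if i < 7 then l ! i else i)"

text \<open>
  A standard path from \<open>X\<^sub>7\<close> to a frame: pass to the right model by a mutation at the centre if
  necessary, then relabel.
\<close>

definition canonical_path :: "frame \<Rightarrow> nat mutation_sequence" where
  "canonical_path s = Perm (frame_perm (snd s)) # (if fst s then [] else [Mut 0])"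

lemma frame_perm_permutes:
  assumes "framing l"
  shows "frame_perm l permutes X7_vertices"
proof (rule bij_imp_permutes)
  have "(!) l ` {..<7} = {..<7}"
    using framingD[OF assms] by (metis lessThan_atLeast0 list.set_map map_nth set_upt)
  then show "bij_betw (frame_perm l) X7_vertices X7_vertices"
    using inj_on_nth_framing[OF assms] unfolding X7_vertices_eq
    by (simp add: bij_betw_def frame_perm_def inj_on_def image_def)
qed (simp add: frame_perm_def)

lemma frame_perm_map:
  assumes "length l = 7" "\<sigma> permutes X7_vertices"
  shows "frame_perm (map \<sigma> l) = \<sigma> \<circ> frame_perm l"
  using assms permutes_not_in[OF assms(2)] by (auto simp: frame_perm_def)

lemma frame_perm_positions [simp]: "frame_perm positions = id"
  by (auto simp: frame_perm_def positions_upt)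

lemma map_frame_perm: "set m \<subseteq> {..<7} \<Longrightarrow> map (frame_perm l) m = reindex l m"
  by (auto simp: frame_perm_def reindex_def)

lemma set_positions: "set positions = {..<7}"
  by (auto simp: positions_upt)

lemma map_frame_perm_positions: "framing l \<Longrightarrow> map (frame_perm l) positions = l"
  by (simp add: map_frame_perm set_positions framingD)

lemma canonical_path_in_mutation_sequences:
  "framing (snd s) \<Longrightarrow> canonical_path s \<in> mutation_sequences X7_vertices"
  by (simp add: canonical_path_def frame_perm_permutes)

lemma run_canonical_path:
  assumes "framing (snd s)"
  shows "run (canonical_path s) base_frame = s"
proof -
  have "position positions 0 = 0" "move True 0 = positions"
    by (simp_all add: positions_def move_def)
  moreover have "reindex positions positions = positions"
    by (simp add: set_positions)
  ultimately show ?thesis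
    using map_frame_perm_positions[OF assms]
    by (cases s) (auto simp: canonical_path_def base_frame_def)
qed

lemma apply_canonical_path:
  assumes "framing (snd s)"
  shows "apply_sequence (canonical_path s) X7 = frame_matrix s"
  using run_framing(2)[of base_frame "canonical_path s"] assms
  by (simp add: canonical_path_in_mutation_sequences run_canonical_path)

lemma canonical_path_map:
  assumes "framing l" "\<sigma> permutes X7_vertices"
  shows "path_equiv X7_vertices X7 (Perm \<sigma> # canonical_path (t, l)) (canonical_path (t, map \<sigma> l))"
proof -
  let ?v = "if t then [] else [Mut 0] :: nat mutation_sequence"
  have "path_equiv X7_vertices X7 ([Perm \<sigma>, Perm (frame_perm l)] @ ?v) ([Perm (\<sigma> \<circ> frame_perm l)] @ ?v)"
    using assms by (intro path_equiv_suffix path_equiv_Perm_Perm frame_perm_permutes)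
      simp_all
  then show ?thesis
    using assms framingD[OF assms(1)] by (simp add: canonical_path_def frame_perm_map)
qed

lemma symmetry_fixes_0: "r \<in> symmetries \<Longrightarrow> r ! 0 = 0"
  by (auto simp: rotations_def reflections_def positions_def)

text \<open>
  The automorphisms of \<open>X\<^sub>7\<close> fix the centre, so their permutations commute with the mutation at \<open>0\<close>.
\<close>

lemma canonical_path_reframe:
  assumes "framing (snd s)" "r \<in> symmetries"
  shows "path_equiv X7_vertices X7 (canonical_path (reframe s r)) (canonical_path s @ [Perm (frame_perm r)])"
proof -
  let ?v = "if fst s then [] else [Mut 0] :: nat mutation_sequence"
  let ?f = "frame_perm (snd s)" and ?g = "frame_perm r"
  have r: "framing r" using assms symmetries_framing by blast
  have perm: "?f permutes X7_vertices" "?g permutes X7_vertices"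
    using assms r by (simp_all add: frame_perm_permutes)
  have "reindex (snd s) r = map ?f r"
    using map_frame_perm framingD[OF r] by simp
  then have "canonical_path (reframe s r) = [Perm (?f \<circ> ?g)] @ ?v"
    using framingD[OF r] perm by (simp add: canonical_path_def reframe_def frame_perm_map)
  also have "path_equiv X7_vertices X7 \<dots> ([Perm ?f, Perm ?g] @ ?v)"
    using perm by (intro path_equiv_suffix path_equiv_sym[OF path_equiv_Perm_Perm])
      simp_all
  also have "path_equiv X7_vertices X7 ([Perm ?g] @ ?v) (?v @ [Perm ?g])"
    using path_equiv_Perm_Mut[OF perm(2), of 0 X7] symmetry_fixes_0[OF assms(2)]
    by (simp add: frame_perm_def)
  then have "path_equiv X7_vertices X7 ([Perm ?f] @ [Perm ?g] @ ?v) ([Perm ?f] @ ?v @ [Perm ?g])"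
    by (rule path_equiv_prefix) (simp add: perm)
  then have "path_equiv X7_vertices X7 ([Perm ?f, Perm ?g] @ ?v) (canonical_path s @ [Perm ?g])"
    by (simp add: canonical_path_def)
  finally show ?thesis .
qed

text \<open>
  Both sides of a relation lead to the same matrix because they lead to the same frame up to rotation.
\<close>

lemma basic_relation_path_equiv:
  assumes "basic_relation X7_vertices (apply_sequence v X7) a b"
    and mem: "a \<in> mutation_sequences X7_vertices" "b \<in> mutation_sequences X7_vertices"
      "v \<in> mutation_sequences X7_vertices"
  shows "path_equiv X7_vertices X7 (a @ v) (b @ v)"
proof -
  have v: "framing (snd (run v base_frame))" "frame_matrix (run v base_frame) = apply_sequence v X7"
    using run_framing[of base_frame v] mem by simp_all
  then have "same_frame (run a (run v base_frame)) (run b (run v base_frame))"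
    using basic_relation_equal_up_to[of "run v base_frame" a b] assms(1) by (simp add: equal_up_to_def)
  then have "frame_matrix (run b (run v base_frame)) = frame_matrix (run a (run v base_frame))"
    using run_framing(1)[OF v(1) mem(1)] by (rule same_frame_matrix)
  then have "apply_sequence a (apply_sequence v X7) = apply_sequence b (apply_sequence v X7)"
    using run_framing(2)[OF v(1)] mem v(2) by simp
  then show ?thesis
    using assms by (intro path_equiv_suffix path_equiv_basicI) simp_all
qed

lemma trace_positions:
  assumes "framing (snd s)" "w \<in> mutation_sequences X7_vertices"
  shows "snd ` set (trace w s) \<subseteq> {..<7}"
  using assms(2)
proof (induction w)
  case (Cons x w)
  then have w: "w \<in> mutation_sequences X7_vertices" "[x] \<in> mutation_sequences X7_vertices"
    using mutation_sequences_Cons by blast+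
  obtain t l where tl: "run w s = (t, l)" by fastforce
  then have "framing l"
    using run_framing(1)[OF assms(1) w(1)] by simp
  then have "snd ` set (visit x (t, l)) \<subseteq> {..<7}"
    using w(2) position_less_7 by (cases x) auto
  then show ?case
    using Cons.IH[OF w(1)] by (simp add: tl image_Un)
qed simp

section \<open>Values of an arbitrary character\<close>

locale X7_character = loop_character A X7_vertices X7 q for A (structure) and q
begin

text \<open>
  The value of a character on the loop that follows the standard path to a model, mutates once, and
  returns along the standard path of the resulting frame.
\<close>

definition step_value :: "bool \<times> nat \<Rightarrow> 'a" where
  "step_value v = ratio (canonical_path (step (Mut (snd v)) (fst v, positions)))
     (Mut (snd v) # canonical_path (fst v, positions))"

definition trace_value :: "(bool \<times> nat) list \<Rightarrow> 'a" where
  "trace_value vs = foldr (\<lambda>v a. step_value v \<otimes> a) vs \<one>"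

lemma trace_value_simps [simp]:
  "trace_value [] = \<one>" "trace_value (v # vs) = step_value v \<otimes> trace_value vs"
  by (simp_all add: trace_value_def)

lemma parallel_canonical_path:
  assumes "framing (snd s)" "w \<in> mutation_sequences X7_vertices"
    and "apply_sequence w X7 = frame_matrix s"
  shows "parallel (canonical_path s) w"
  using assms by (simp add: parallel_def canonical_path_in_mutation_sequences apply_canonical_path)

lemma parallel_canonical_path_run:
  "w \<in> mutation_sequences X7_vertices \<Longrightarrow> parallel (canonical_path (run w base_frame)) w"
  using run_framing[of base_frame w] by (intro parallel_canonical_path) simp_all

lemma parallel_canonical_path_step:
  assumes "framing (snd s)" "[x] \<in> mutation_sequences X7_vertices"
  shows "parallel (canonical_path (step x s)) (x # canonical_path s)"
  using assms
  by (intro parallel_canonical_path framing_step)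
     (simp_all add: frame_matrix_step apply_canonical_path canonical_path_in_mutation_sequences
       mutation_sequences_Cons[of x "canonical_path s"])

lemma step_value_closed [simp]: "p < 7 \<Longrightarrow> step_value (t, p) \<in> carrier A"
  unfolding step_value_def
  by (intro ratio_closed parallel_canonical_path_step) simp_all

lemma trace_value_closed [simp]: "snd ` set vs \<subseteq> {..<7} \<Longrightarrow> trace_value vs \<in> carrier A"
  by (induction vs) auto

text \<open>
  Labels do not matter for the value of a step: all paths involved begin with the standard path to a
  model, and the permutation that introduces the labels can be moved to the left, where it cancels.
\<close>

lemma ratio_step:
  assumes s: "framing (snd s)" and x: "[x] \<in> mutation_sequences X7_vertices"
  shows "ratio (canonical_path (step x s)) (x # canonical_path s) = trace_value (visit x s)"
proof -
  obtain t l where tl: "s = (t, l)" by fastforce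
  then have l: "framing l" using s by simp
  note par = parallel_canonical_path_step[OF s x]
  show ?thesis
  proof (cases x)
    case (Perm \<sigma>)
    then have \<sigma>: "\<sigma> permutes X7_vertices" using x by simp
    have "path_equiv X7_vertices X7 (x # canonical_path s) (canonical_path (step x s))"
      using canonical_path_map[OF l \<sigma>] by (simp add: Perm tl)
    from ratio_path_equiv[OF path_equiv_refl this par] par show ?thesis
      by (simp add: Perm tl parallel_def)
  next
    case (Mut k)
    then have k: "k \<in> X7_vertices" using x by simp
    obtain p where p: "p < 7" "k = l ! p" "position l k = p"
      using framing_cases[OF l k] .
    let ?f = "frame_perm l" and ?b = "(t, positions)"
    let ?D = "canonical_path ?b" and ?D' = "canonical_path (step (Mut p) ?b)"
    have f: "?f permutes X7_vertices" "?f p = k"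
      using l p by (simp_all add: frame_perm_permutes) (simp add: frame_perm_def)
    have "position positions p = p"
      using position_nth[of positions p] p(1) by (simp add: positions_upt)
    moreover have "p \<in> set positions" using p by simp
    then have m: "framing (move t p)" using move_framing by blast
    ultimately have sb: "step (Mut p) ?b = (t \<noteq> (p = 0), move t p)"
      using framingD[OF m] by simp
    have "step x s = (t \<noteq> (p = 0), map ?f (move t p))"
      using framingD[OF m] p(3) by (simp add: Mut tl map_frame_perm)
    then have 1: "path_equiv X7_vertices X7 (canonical_path (step x s)) (Perm ?f # ?D')"
      using path_equiv_sym[OF canonical_path_map[OF m f(1)]] sb by simp
    have D: "?D \<in> mutation_sequences X7_vertices"
      by (simp add: canonical_path_in_mutation_sequences)
    have "l = map ?f positions"
      by (simp add: map_frame_perm_positions l)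
    then have "path_equiv X7_vertices X7 (canonical_path s) (Perm ?f # ?D)"
      using path_equiv_sym[OF canonical_path_map[OF framing_positions f(1), of t]] by (simp add: tl)
    then have "path_equiv X7_vertices X7 ([Mut k] @ canonical_path s) ([Mut k] @ Perm ?f # ?D)"
      by (rule path_equiv_prefix) (use k in simp)
    also have "path_equiv X7_vertices X7 ([Mut k, Perm ?f] @ ?D) ([Perm ?f, Mut p] @ ?D)"
      using path_equiv_sym[OF path_equiv_Perm_Mut[OF f(1), of p]] f(2) p(1) D
      by (intro path_equiv_suffix) simp_all
    then have "path_equiv X7_vertices X7 ([Mut k] @ Perm ?f # ?D) ([Perm ?f] @ Mut p # ?D)"
      by simp
    finally have 2: "path_equiv X7_vertices X7 (x # canonical_path s) ([Perm ?f] @ Mut p # ?D)"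
      by (simp add: Mut)
    have "parallel ?D' (Mut p # ?D)"
      using p(1) by (intro parallel_canonical_path_step) simp_all
    then have "ratio ([Perm ?f] @ ?D') ([Perm ?f] @ Mut p # ?D) = step_value (t, p)"
      using ratio_prefix[of ?D' "Mut p # ?D" "[Perm ?f]"] f by (simp add: step_value_def)
    then show ?thesis
      using ratio_path_equiv[OF 1 2 par] p by (simp add: Mut tl)
  qed
qed

text \<open>
  Return to the starting point after each letter along the standard path: every path becomes a product
  of single steps, followed by the standard path to its end.
\<close>

lemma ratio_canonical_path:
  assumes "w \<in> mutation_sequences X7_vertices"
  shows "ratio (canonical_path (run w base_frame)) w = trace_value (trace w base_frame)"
  using assms
proof (induction w)
  case Nil
  have "path_equiv X7_vertices X7 (canonical_path base_frame) []"
    using path_equiv_Perm_id[of X7_vertices X7] by (simp add: canonical_path_def base_frame_def)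
  moreover have "parallel (canonical_path base_frame) []"
    using parallel_canonical_path_run[of "[]"] by simp
  ultimately show ?case
    using ratio_path_equiv[OF _ path_equiv_refl] by simp
next
  case (Cons x w)
  then have w: "[x] \<in> mutation_sequences X7_vertices" "w \<in> mutation_sequences X7_vertices"
    using mutation_sequences_Cons by blast+
  let ?s = "run w base_frame"
  have s: "framing (snd ?s)" using w run_framing(1) by simp
  note p1 = parallel_canonical_path_step[OF s w(1)] and p2 = parallel_canonical_path_run[OF w(2)]
  have p3: "parallel (x # canonical_path ?s) (x # w)"
    using p2 w(1) mutation_sequences_Cons unfolding parallel_def by (metis apply_sequence_simps(2))
  have "ratio (canonical_path (step x ?s)) (x # w)
      = ratio (canonical_path (step x ?s)) (x # canonical_path ?s) \<otimes> ratio (x # canonical_path ?s) (x # w)"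
    by (rule ratio_cancel[OF p1 p3, symmetric])
  also have "ratio (x # canonical_path ?s) (x # w) = ratio (canonical_path ?s) w"
    using ratio_prefix[OF p2 w(1)] by simp
  finally have "ratio (canonical_path (run (x # w) base_frame)) (x # w)
      = trace_value (visit x ?s) \<otimes> trace_value (trace w base_frame)"
    using Cons.IH[OF w(2)] ratio_step[OF s w(1)] by simp
  also have "\<dots> = trace_value (visit x ?s @ trace w base_frame)"
  proof -
    have "trace_value (us @ vs) = trace_value us \<otimes> trace_value vs"
      if "snd ` set us \<subseteq> {..<7}" "snd ` set vs \<subseteq> {..<7}" for us vs
      using that by (induction us) (auto simp: m_assoc)
    moreover have "snd ` set (visit x ?s) \<subseteq> {..<7}"
      using trace_positions[OF s w(1)] by simp
    ultimately show ?thesis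
      using trace_positions[OF _ w(2), of base_frame] by simp
  qed
  finally show ?case by simp
qed

subsection \<open>Symmetries\<close>

definition symmetry_value :: "nat list \<Rightarrow> 'a" where
  "symmetry_value r = q [Perm (frame_perm r)]"

lemma symmetry_loop:
  assumes "r \<in> symmetries"
  shows "[Perm (frame_perm r)] \<in> mutation_loops X7_vertices X7"
proof -
  have r: "framing r" using assms symmetries_framing by blast
  then have "canonical_path (True, r) = [Perm (frame_perm r)]"
    by (simp add: canonical_path_def)
  moreover have "reframe (True, positions) r = (True, r)"
    using framingD[OF r] by (simp add: reframe_def)
  ultimately show ?thesis
    using apply_canonical_path[of "(True, r)"] frame_matrix_reframe[of positions r True] assms r
      frame_perm_permutes[OF r]
    by (simp add: mutation_loops_def frame_matrix_base)
qed

lemma symmetry_value_closed [simp]: "r \<in> symmetries \<Longrightarrow> symmetry_value r \<in> carrier A"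
  unfolding symmetry_value_def by (intro character_closed symmetry_loop)

lemma symmetry_value_reindex:
  assumes "r \<in> symmetries" "r' \<in> symmetries"
  shows "symmetry_value r \<otimes> symmetry_value r' = symmetry_value (reindex r r')"
proof -
  have f: "framing r" "framing r'" using assms symmetries_framing by blast+
  have "frame_perm (reindex r r') = frame_perm r \<circ> frame_perm r'"
    using frame_perm_map[of r' "frame_perm r"] framingD[OF f(2)] frame_perm_permutes[OF f(1)]
    by (simp add: map_frame_perm)
  then have "path_equiv X7_vertices X7 ([Perm (frame_perm r)] @ [Perm (frame_perm r')])
      [Perm (frame_perm (reindex r r'))]"
    using path_equiv_Perm_Perm[OF frame_perm_permutes[OF f(1)] frame_perm_permutes[OF f(2)]] by simp
  then show ?thesis
    unfolding symmetry_value_def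
    using character_path_equiv symmetry_loop[OF assms(1)] symmetry_loop[OF assms(2)]
    by (metis append_in_mutation_loops character_append)
qed

text \<open>
  Only the parity of a symmetry is visible in a commutative group. With \<open>a\<close> the rotation and \<open>b\<close> a
  reflection, \<open>a b = b a\<inverse>\<close> gives that \<open>a\<close> and \<open>a\<inverse> = a\<^sup>2\<close> have the same value, which is thus trivial.
\<close>

lemma symmetry_values:
  shows "r \<in> set rotations \<Longrightarrow> symmetry_value r = \<one>"
    and "r \<in> set reflections \<Longrightarrow> symmetry_value r = symmetry_value [0, 3, 4, 1, 2, 5, 6]"
    and "symmetry_value [0, 3, 4, 1, 2, 5, 6] \<otimes> symmetry_value [0, 3, 4, 1, 2, 5, 6] = \<one>"
proof -
  let ?v = symmetry_value
  let ?a = "[0, 3, 4, 5, 6, 1, 2]" and ?a' = "[0, 5, 6, 1, 2, 3, 4]"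
  let ?b = "[0, 3, 4, 1, 2, 5, 6]" and ?c = "[0, 1, 2, 5, 6, 3, 4]" and ?d = "[0, 5, 6, 3, 4, 1, 2]"
  have mem: "?a \<in> symmetries" "?a' \<in> symmetries" "?b \<in> symmetries" "?c \<in> symmetries" "?d \<in> symmetries"
    by (simp_all add: rotations_def reflections_def)
  note closed = mem[THEN symmetry_value_closed]
  have one: "?v positions = \<one>"
    using character_path_equiv[OF path_equiv_Perm_id] symmetry_loop[of positions]
    by (simp add: symmetry_value_def rotations_def)
  have eqs: "reindex ?a ?a' = positions" "reindex ?b ?b = positions" "reindex ?d ?d = positions"
    "reindex ?a ?b = ?d" "reindex ?b ?a' = ?d" "reindex ?a' ?b = ?c" "reindex ?b ?a = ?c"
    by code_simp+
  note mult = symmetry_value_reindex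
  have bb: "?v ?b \<otimes> ?v ?b = \<one>" and dd: "?v ?d \<otimes> ?v ?d = \<one>" and aa': "?v ?a \<otimes> ?v ?a' = \<one>"
    using mult[OF mem(3,3)] mult[OF mem(5,5)] mult[OF mem(1,2)] eqs one by simp_all
  have d: "?v ?a \<otimes> ?v ?b = ?v ?d" "?v ?b \<otimes> ?v ?a' = ?v ?d" and c: "?v ?b \<otimes> ?v ?a = ?v ?c"
    using mult[OF mem(1,3)] mult[OF mem(3,2)] mult[OF mem(3,1)] eqs by simp_all
  have "?v ?a = ?v ?a'"
    using d closed right_cancel[of "?v ?a'" "?v ?a" "?v ?b"] m_comm[of "?v ?b" "?v ?a'"] by simp
  then have aaa: "?v ?a = ?v ?a'" "?v ?a \<otimes> ?v ?a = \<one>"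
    using aa' by simp_all
  have "reindex ?a ?a = ?a'" by code_simp
  then have "?v ?a \<otimes> ?v ?a = ?v ?a'"
    using mult[OF mem(1,1)] by simp
  then have a: "?v ?a = \<one>" "?v ?a' = \<one>" using aaa by simp_all
  show "?v r = \<one>" if "r \<in> set rotations"
    using that a one by (auto simp: rotations_def)
  show "?v r = ?v ?b" if "r \<in> set reflections"
    using that a c d closed by (auto simp: reflections_def)
  show "?v ?b \<otimes> ?v ?b = \<one>" by (rule bb)
qed

text \<open>
  The choice of a frame among its rotations is invisible to a character, because rotations have
  trivial value.
\<close>

lemma ratio_same_frame:
  assumes "framing (snd s)" "same_frame s s'" "parallel (canonical_path s) w"
  shows "ratio (canonical_path s') w = ratio (canonical_path s) w"
proof -
  obtain r where r: "r \<in> set rotations" "s' = reframe s r"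
    using assms unfolding same_frame_def by blast
  let ?c = "canonical_path s" and ?x = "[Perm (frame_perm r)]"
  have x: "?x \<in> mutation_loops X7_vertices X7"
    using symmetry_loop r by blast
  have c: "?c \<in> mutation_sequences X7_vertices"
    using assms(1) by (rule canonical_path_in_mutation_sequences)
  have par: "parallel ?c (?c @ ?x)" "parallel (?c @ ?x) w"
    using x c assms(3) by (simp_all add: parallel_def mutation_loops_def)
  have eq: "path_equiv X7_vertices X7 (canonical_path s') (?c @ ?x)"
    using canonical_path_reframe[OF assms(1), of r] r by simp
  have "parallel (canonical_path s') w"
    using par(2) path_equiv_invariants[OF eq] by (simp add: parallel_def)
  then have "ratio (canonical_path s') w = ratio (?c @ ?x) w"
    using ratio_path_equiv[OF eq path_equiv_refl] by simp
  moreover have "ratio ?c (?c @ ?x) \<otimes> ratio (?c @ ?x) w = ratio ?c w"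
    using par by (rule ratio_cancel)
  moreover have "ratio ?c (?c @ ?x) = \<one>"
    using ratio_append_loop[OF c x] symmetry_values(1)[OF r(1)] by (simp add: symmetry_value_def)
  ultimately show ?thesis
    using par by simp
qed

text \<open>
  Every relation of the group becomes a relation between the values of single steps, which is read off
  from the traces of its two sides.
\<close>

lemma trace_value_path_equiv:
  assumes eq: "path_equiv X7_vertices X7 w w'" and w: "w \<in> mutation_sequences X7_vertices"
  shows "trace_value (trace w base_frame) = trace_value (trace w' base_frame)"
proof -
  let ?c = "canonical_path (run w base_frame)"
  have f: "framing (snd (run w base_frame))"
    using w run_framing(1) by simp
  have w': "w' \<in> mutation_sequences X7_vertices" 
    using path_equiv_invariants[OF eq] w by simp
  have par: "parallel ?c w" "parallel ?c w'"
    using parallel_canonical_path_run[OF w] path_equiv_invariants[OF eq]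
    by (simp_all add: parallel_def)
  have "ratio ?c w = ratio ?c w'"
    by (rule ratio_path_equiv[OF path_equiv_refl eq par(1)])
  also have "\<dots> = ratio (canonical_path (run w' base_frame)) w'"
    using ratio_same_frame[OF f _ par(2)] path_equiv_equal_up_to[OF eq w]
    by (simp add: equal_up_to_def)
  finally show ?thesis
    by (simp add: ratio_canonical_path w w')
qed

text \<open>
  Precomposition with a rotation of \<open>X\<^sub>7\<close> changes the positions at which a path mutates, but not its
  value.
\<close>

lemma trace_value_rotation:
  assumes r: "r \<in> set rotations" and w: "w \<in> mutation_sequences X7_vertices"
  shows "trace_value (trace w (True, r)) = trace_value (trace w base_frame)"
proof -
  let ?c = "canonical_path (run w base_frame)" and ?x = "[Perm (frame_perm r)]"
  have fr: "framing r" using r by (rule rotation_framing)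
  have f: "framing (snd (run w base_frame))"
    using w run_framing(1) by simp
  have x: "?x \<in> mutation_loops X7_vertices X7" "?x \<in> mutation_sequences X7_vertices"
    using symmetry_loop[of r] r by (simp_all add: mutation_loops_def)
  have run: "run ?x base_frame = (True, r)"
    using run_canonical_path[of "(True, r)"] fr by (simp add: canonical_path_def)
  moreover have "(True, r) = reframe base_frame r"
    using framingD[OF fr] by (simp add: reframe_def base_frame_def)
  ultimately have "same_frame (reframe (run w base_frame) r) (run (w @ ?x) base_frame)"
    using run_reframe(1)[OF framing_base_frame w, of r] r by simp
  then have same: "same_frame (run w base_frame) (run (w @ ?x) base_frame)"
    using r same_frame_trans unfolding same_frame_def by blast
  have par: "parallel ?c w" "parallel w (w @ ?x)"
    using parallel_canonical_path_run[OF w] x w by (simp_all add: parallel_def mutation_loops_def)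
  then have "parallel ?c (w @ ?x)"
    by (simp add: parallel_def)
  have "trace_value (trace w (True, r)) = trace_value (trace (w @ ?x) base_frame)"
    using run by (simp add: base_frame_def)
  also have "\<dots> = ratio (canonical_path (run (w @ ?x) base_frame)) (w @ ?x)"
    using w x by (simp only: ratio_canonical_path mutation_sequences_simps)
  also have "\<dots> = ratio ?c (w @ ?x)"
    by (rule ratio_same_frame[OF f same]) fact
  also have "\<dots> = ratio ?c w \<otimes> ratio w (w @ ?x)"
    by (rule ratio_cancel[OF par, symmetric])
  also have "\<dots> = ratio ?c w"
    using ratio_append_loop[OF w x(1)] symmetry_values(1)[OF r] par by (simp add: symmetry_value_def)
  also have "\<dots> = trace_value (trace w base_frame)"
    by (rule ratio_canonical_path[OF w])
  finally show ?thesis .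
qed

subsection \<open>Relations between the values of single steps\<close>

lemma step_value_centre: "step_value (t, 0) = \<one>"
proof -
  have "step (Mut 0) (True, positions) = (False, positions)"
    by code_simp
  then have "canonical_path (step (Mut 0) (True, positions)) = [Perm id] @ [Mut 0]"
    by (simp only:) (simp add: canonical_path_def)
  moreover have "Mut 0 # canonical_path (True, positions) = [Mut 0] @ [Perm id]"
    by (simp add: canonical_path_def)
  moreover have "path_equiv X7_vertices X7 ([Perm id] @ [Mut 0]) ([] @ [Mut 0])"
    by (intro path_equiv_suffix path_equiv_Perm_id) simp
  moreover have "path_equiv X7_vertices X7 ([Mut 0] @ [Perm id]) ([Mut 0] @ [])"
    by (intro path_equiv_prefix path_equiv_Perm_id) simp
  moreover have "parallel ([Perm id] @ [Mut 0]) ([Mut 0] @ [Perm id])"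
    by (simp add: parallel_def permutes_id permute_matrix_def)
  ultimately have T: "step_value (True, 0) = \<one>"
    using ratio_path_equiv[of "[Perm id] @ [Mut 0]" "[] @ [Mut 0]"
        "[Mut 0] @ [Perm id]" "[Mut 0] @ []"]
    by (simp only: step_value_def fst_conv snd_conv) simp
  \<comment> \<open>The step back from the second model to \<open>X\<^sub>7\<close> is inverse to the step just treated.\<close>
  have "path_equiv X7_vertices X7 [Mut 0, Mut 0] []"
    using inverse_path_equiv[of "[Mut 0]" X7_vertices X7] by (simp add: inverse_sequence_def)
  then have "trace_value (trace [Mut 0, Mut 0] base_frame) = trace_value (trace [] base_frame)"
    by (rule trace_value_path_equiv) simp
  moreover have "trace [Mut 0, Mut 0] base_frame = [(False, 0), (True, 0)]"
    by code_simp
  ultimately have "step_value (False, 0) = \<one>"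
    using T by (simp del: trace.simps(2))
  with T show ?thesis by (cases t) simp_all
qed

lemma step_value_rotation:
  assumes r: "r \<in> set rotations" and p: "p < 7"
  shows "step_value (t, r ! p) = step_value (t, p)"
proof -
  let ?w = "Mut (r ! p) # canonical_path (t, positions)"
  let ?vs = "if t then [] else [(True, 0)]"
  have fr: "framing r" using r by (rule rotation_framing)
  have rp: "r ! p < 7" "r ! 0 = 0"
    using nth_mem[of p r] framingD[OF fr] p symmetry_fixes_0[of r] r by auto
  have pos: "position r (r ! p) = p" "position r 0 = 0" "position positions (r ! p) = r ! p"
    "position positions 0 = 0"
    using position_nth[of r p] position_nth[of r 0] framingD[OF fr] p rp
      position_nth[of positions "r ! p"]
    by (simp_all add: positions_upt upt_rec)
  have "?w \<in> mutation_sequences X7_vertices"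
    using rp by (simp add: canonical_path_in_mutation_sequences)
  from trace_value_rotation[OF r this]
  have "trace_value (trace ?w (True, r)) = trace_value (trace ?w base_frame)" .
  moreover have "trace ?w base_frame = (t, r ! p) # ?vs"
    using run_canonical_path[of "(t, positions)"] pos
    by (simp add: canonical_path_def base_frame_def)
  moreover have "trace ?w (True, r) = (t, p) # ?vs"
    using pos framingD[OF fr] by (simp add: canonical_path_def move_def)
  ultimately show ?thesis
    using p rp by (simp add: step_value_centre split: if_splits)
qed

lemma trace_Perm: "trace (Perm \<sigma> # w) s = trace w s"
  by (cases "run w s") simp

lemma relation_values:
  assumes "basic_relation X7_vertices (apply_sequence v X7) a b"
    and "a \<in> mutation_sequences X7_vertices" "b \<in> mutation_sequences X7_vertices"
      "v \<in> mutation_sequences X7_vertices"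
  shows "trace_value (trace (a @ v) base_frame) = trace_value (trace (b @ v) base_frame)"
  using assms by (intro trace_value_path_equiv basic_relation_path_equiv) simp_all

text \<open>
  Write \<open>x\<^sub>p\<close> and \<open>y\<^sub>p\<close> for the values of the second model and of \<open>X\<^sub>7\<close> at position \<open>p\<close>. The
  involutions give the first two equations, and the pentagon of \<open>X\<^sub>7\<close> between the centre and vertex 1
  gives the third. The pentagon of the second model between the vertices 1 and 4 mutates successively
  at positions 1, 5, 3, 1, 5, always at the first vertex of a pair, which yields \<open>x\<^sub>1\<^sup>5 = 1\<close>.
\<close>

lemma step_value_relations:
  shows "step_value (False, 2) \<otimes> step_value (False, 1) = \<one>"
    and "step_value (True, 2) \<otimes> step_value (True, 1) = \<one>"
    and "step_value (False, 1) \<otimes> step_value (False, 1) \<otimes> step_value (True, 2) = \<one>"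
    and "step_value (False, 1) [^] (5 :: nat) = \<one>"
proof -
  have rot: "step_value (False, 3) = step_value (False, 1)" "step_value (False, 5) = step_value (False, 1)"
    using step_value_rotation[of "[0, 3, 4, 5, 6, 1, 2]" 1 False]
      step_value_rotation[of "[0, 5, 6, 1, 2, 3, 4]" 1 False]
    by (simp_all add: rotations_def)
  have X: "apply_sequence [Mut 0] X7 = frame_matrix (False, positions)"
  proof -
    have "run [Mut 0] base_frame = (False, positions)" by code_simp
    then show ?thesis
      using run_framing(2)[of base_frame "[Mut 0]"] by simp
  qed
  have centre: "trace [Mut 0] base_frame = [(True, 0)]"
    by code_simp
  have "trace [Mut 1, Mut 1, Mut 0] base_frame = [(False, 2), (False, 1), (True, 0)]"
    by code_simp
  with centre show "step_value (False, 2) \<otimes> step_value (False, 1) = \<one>"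
    using relation_values[OF basic_relation.involution, of 1 "[Mut 0]"]
    by (simp add: step_value_centre del: trace.simps(2) trace_append)
  have "trace [Mut 1, Mut 1] base_frame = [(True, 2), (True, 1)]"
    by code_simp
  then show "step_value (True, 2) \<otimes> step_value (True, 1) = \<one>"
    using relation_values[OF basic_relation.involution, of 1 "[]"]
    by (simp del: trace.simps(2) trace_append)
  have "trace [Mut 0, Mut 1, Mut 0, Mut 1, Mut 0] base_frame
      = [(True, 2), (False, 0), (False, 1), (False, 1), (True, 0)]"
    by code_simp
  moreover have "X7 0 1 = 1"
    by (simp add: X7_def X7_arrows_def)
  ultimately have "step_value (True, 2) \<otimes> (step_value (False, 1) \<otimes> step_value (False, 1)) = \<one>"
    using relation_values[of "[]", OF basic_relation.pentagon, of 0 1]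
    by (simp add: step_value_centre permutes_swap_id trace_Perm del: trace.simps(2) trace_append)
  then show "step_value (False, 1) \<otimes> step_value (False, 1) \<otimes> step_value (True, 2) = \<one>"
    by (simp add: m_comm)
  have "trace [Mut 1, Mut 4, Mut 1, Mut 4, Mut 1, Mut 0] base_frame
      = [(False, 5), (False, 1), (False, 3), (False, 5), (False, 1), (True, 0)]"
    by code_simp
  moreover have "frame_matrix (False, positions) 1 4 = - 1"
    using frame_matrix_nth[OF framing_positions, of 1 4 False] by (simp add: positions_def quiver_rows_def)
  ultimately have "step_value (False, 1) \<otimes> (step_value (False, 1) \<otimes> (step_value (False, 1) \<otimes>
      (step_value (False, 1) \<otimes> step_value (False, 1)))) = \<one>"
    using relation_values[of "[Mut 0]", OF basic_relation.pentagon, of 1 4] X rot centre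
    by (simp add: step_value_centre permutes_swap_id trace_Perm del: trace.simps(2) trace_append)
  moreover have "x [^] (5 :: nat) = x \<otimes> (x \<otimes> (x \<otimes> (x \<otimes> x)))" if "x \<in> carrier A" for x
    using that by (simp add: numeral_eq_Suc m_assoc)
  ultimately show "step_value (False, 1) [^] (5 :: nat) = \<one>"
    by simp
qed

subsection \<open>Every character is determined by its values on the two generators\<close>

text \<open>
  The loop \<open>\<psi>\<^sub>1\<close> mutates at the centre, then at the first vertex of the first pair, then at the centre
  again, and its permutation restores the initial frame.
\<close>

lemma character_psi: "q \<psi>\<^sub>1 = step_value (False, 1)"
proof -
  have mem: "\<psi>\<^sub>1 \<in> mutation_sequences X7_vertices"
    using \<psi>\<^sub>1_in_mutation_loops by (simp add: mutation_loops_def)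
  have run: "run \<psi>\<^sub>1 base_frame = base_frame" "trace \<psi>\<^sub>1 base_frame = [(False, 0), (False, 1), (True, 0)]"
    unfolding \<psi>\<^sub>1_def by code_simp+
  have "parallel (canonical_path base_frame) \<psi>\<^sub>1"
    using parallel_canonical_path_run[OF mem] run by simp
  moreover have "path_equiv X7_vertices X7 (canonical_path base_frame) []"
    using path_equiv_Perm_id[of X7_vertices X7] by (simp add: canonical_path_def base_frame_def)
  ultimately have "ratio (canonical_path base_frame) \<psi>\<^sub>1 = ratio [] \<psi>\<^sub>1"
    using ratio_path_equiv[OF _ path_equiv_refl] by simp
  also have "\<dots> = q \<psi>\<^sub>1"
    by (simp add: ratio_def inverse_sequence_def)
  finally show ?thesis
    using ratio_canonical_path[OF mem] run by (simp add: step_value_centre)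
qed

lemma step_value_power:
  assumes "p < 7"
  shows "step_value (t, p) = q \<psi>\<^sub>1 [^] weight (t, p)"
proof -
  let ?x = "step_value (False, 1)" and ?y = "step_value (True, 1)"
  have x: "?x \<in> carrier A" and y: "?y \<in> carrier A" by simp_all
  have x2: "step_value (False, 2) = inv ?x" and y2: "step_value (True, 2) = inv ?y"
    using step_value_relations(1,2) by (simp_all add: inv_equality[symmetric])
  have "?x \<otimes> ?x = ?y"
    using step_value_relations(3) x y inv_equality[of "?x \<otimes> ?x" "inv ?y"] by (simp add: y2)
  moreover have two: "x [^] (2 :: int) = x \<otimes> x" if "x \<in> carrier A" for x
    using int_pow_mult[OF that, of 1 1] that by simp
  ultimately have y_eq: "?y = ?x [^] (2 :: int)" using x by simp
  have odd: "step_value (t, p) = step_value (t, 1)" if "p \<in> {1, 3, 5}"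
    using that step_value_rotation[of "[0, 3, 4, 5, 6, 1, 2]" 1 t]
      step_value_rotation[of "[0, 5, 6, 1, 2, 3, 4]" 1 t]
    by (auto simp: rotations_def)
  have even: "step_value (t, p) = step_value (t, 2)" if "p \<in> {2, 4, 6}"
    using that step_value_rotation[of "[0, 3, 4, 5, 6, 1, 2]" 2 t]
      step_value_rotation[of "[0, 5, 6, 1, 2, 3, 4]" 2 t]
    by (auto simp: rotations_def)
  have "p \<in> {0} \<union> {1, 3, 5} \<union> {2, 4, 6}" using assms by auto
  then consider "p = 0" | "p \<in> {1, 3, 5}" | "p \<in> {2, 4, 6}" by blast
  then show ?thesis
  proof cases
    case 1
    then show ?thesis by (simp add: step_value_centre)
  next
    case 2
    then have "p \<noteq> 0" "odd p" by auto
    then show ?thesis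
      using odd[OF 2] x y_eq by (cases t) (simp_all add: character_psi)
  next
    case 3
    then have "p \<noteq> 0" "\<not> odd p" by auto
    then show ?thesis
      using even[OF 3] x y_eq x2 y2 int_pow_neg[OF x, of 1] int_pow_neg[OF x, of 2]
      by (cases t) (simp_all add: character_psi)
  qed
qed

lemma trace_value_power:
  "snd ` set vs \<subseteq> {..<7} \<Longrightarrow> trace_value vs = q \<psi>\<^sub>1 [^] sum_list (map weight vs)"
proof (induction vs)
  case (Cons v vs)
  obtain t p where v: "v = (t, p)" by fastforce
  have "q \<psi>\<^sub>1 \<in> carrier A" by (simp add: character_psi)
  then show ?case
    using Cons step_value_power[of p t] by (simp add: v int_pow_mult del: weight.simps)
qed simp

lemma frame_perm_sigma: "frame_perm [0, 3, 4, 1, 2, 5, 6] = transpose 1 3 \<circ> transpose 2 4"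
proof
  fix i :: nat
  have "\<forall>i<7. [0, 3, 4, 1, 2, 5, 6] ! i = (transpose 1 3 \<circ> transpose 2 (4 :: nat)) i"
    unfolding all_less_7 by (simp add: transpose_def)
  then show "frame_perm [0, 3, 4, 1, 2, 5, 6] i = (transpose 1 3 \<circ> transpose 2 4) i"
    by (simp add: frame_perm_def transpose_def)
qed

text \<open>
  A loop is a product of single steps and of the permutation of its final frame. The permutation
  contributes a power of \<open>\<sigma>\<^sub>1\<^sub>3\<close> given by the parity, and the steps contribute powers of \<open>\<psi>\<^sub>1\<close> that
  add up to the weight.
\<close>

lemma character_formula:
  assumes "w \<in> mutation_loops X7_vertices X7"
  shows "q w = q \<psi>\<^sub>1 [^] fst (invariant w) \<otimes> q \<sigma>\<^sub>1\<^sub>3 [^] snd (invariant w)"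
proof -
  let ?r = "final_frame w" and ?n = "total_weight w base_frame"
  note run = run_loop[OF assms]
  have r: "framing ?r" using run(2) symmetries_framing by blast
  have w: "w \<in> mutation_sequences X7_vertices"
    using assms by (simp add: mutation_loops_def)
  let ?x = "[Perm (frame_perm ?r)]"
  have can: "canonical_path (run w base_frame) = ?x"
    by (simp add: run canonical_path_def)
  have x: "?x \<in> mutation_loops X7_vertices X7"
    using run(2) by (rule symmetry_loop)
  have \<psi>: "q \<psi>\<^sub>1 \<in> carrier A" "q \<psi>\<^sub>1 [^] (5 :: int) = \<one>"
    using step_value_relations(4) int_pow_int[of A "q \<psi>\<^sub>1" 5] by (simp_all add: character_psi)
  have "parallel [] ?x" "parallel ?x w"
    using x assms by (simp_all add: parallel_def mutation_loops_def)
  then have "q w = q ?x \<otimes> ratio ?x w"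
    using ratio_cancel[of "[]" ?x w] by (simp add: ratio_def inverse_sequence_def)
  also have "ratio ?x w = trace_value (trace w base_frame)"
    using ratio_canonical_path[OF w] can by simp
  also have "\<dots> = q \<psi>\<^sub>1 [^] ?n"
    using trace_value_power trace_positions[OF _ w] by (simp add: total_weight_def)
  also have "\<dots> = q \<psi>\<^sub>1 [^] (5 * (?n div 5) + ?n mod 5)"
    by simp
  also have "\<dots> = q \<psi>\<^sub>1 [^] (?n mod 5)"
    using \<psi> int_pow_pow[of "q \<psi>\<^sub>1" 5 "?n div 5"] by (simp only: int_pow_mult) simp
  also have "q ?x = q \<sigma>\<^sub>1\<^sub>3 [^] snd (invariant w)"
  proof -
    have "q \<sigma>\<^sub>1\<^sub>3 = symmetry_value [0, 3, 4, 1, 2, 5, 6]"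
      by (simp only: symmetry_value_def frame_perm_sigma \<sigma>\<^sub>1\<^sub>3_def)
    moreover have "\<dots> \<in> carrier A"
      by (simp add: reflections_def)
    ultimately show ?thesis
      using symmetry_values(1,2)[of ?r] run(2) by (auto simp: symmetry_value_def[symmetric] invariant_def)
  qed
  finally show ?thesis
    using \<psi> \<sigma>\<^sub>1\<^sub>3_in_mutation_loops by (simp add: m_comm invariant_def)
qed

end

section \<open>The abelianization\<close>

lemma invariant_generators: "invariant \<psi>\<^sub>1 = (1, 0)" "invariant \<sigma>\<^sub>1\<^sub>3 = (0, 1)"
  unfolding \<psi>\<^sub>1_def \<sigma>\<^sub>1\<^sub>3_def by code_simp+

lemma invariant_surjective:
  assumes "z \<in> carrier (integer_mod_group 5 \<times>\<times> integer_mod_group 2)"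
  shows "\<exists>w\<in>mutation_loops X7_vertices X7. invariant w = z"
proof -
  obtain a b where ab: "z = (a, b)" "0 \<le> a" "a < 5" "0 \<le> b" "b < 2"
    using assms by (auto simp: carrier_integer_mod_group)
  then have z: "z = (a, b)" "0 \<le> a" "a < 5" "b = 0 \<or> b = 1"
    by linarith+
  have "\<exists>w\<in>mutation_loops X7_vertices X7. invariant w = (int n mod 5, 0)" for n
  proof (induction n)
    case 0
    have "invariant [] = (0, 0)" by code_simp
    then show ?case using Nil_in_mutation_loops by fastforce
  next
    case (Suc n)
    then obtain w where w: "w \<in> mutation_loops X7_vertices X7" "invariant w = (int n mod 5, 0)"
      by blast
    then have "invariant (w @ \<psi>\<^sub>1) = (int (Suc n) mod 5, 0)"
      by (simp add: invariant_append \<psi>\<^sub>1_in_mutation_loops invariant_generators mod_simps add.commute)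
    then show ?case
      using w append_in_mutation_loops \<psi>\<^sub>1_in_mutation_loops by blast
  qed
  from this[of "nat a"] z obtain w where w: "w \<in> mutation_loops X7_vertices X7" "invariant w = (a, 0)"
    by auto
  then have "invariant (w @ \<sigma>\<^sub>1\<^sub>3) = (a, 1)"
    using z by (simp add: invariant_append \<sigma>\<^sub>1\<^sub>3_in_mutation_loops invariant_generators)
  then show ?thesis
    using z w append_in_mutation_loops[OF w(1) \<sigma>\<^sub>1\<^sub>3_in_mutation_loops] by auto
qed

theorem corollary1p4:
  shows "\<exists>\<phi> \<in> iso (abelianization \<Gamma>_X7) (integer_mod_group 5 \<times>\<times> integer_mod_group 2).
      \<phi> (abelianization_map \<Gamma>_X7 (loop_class X7_vertices X7 \<psi>\<^sub>1)) = (1, 0) \<and>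
      \<phi> (abelianization_map \<Gamma>_X7 (loop_class X7_vertices X7 \<sigma>\<^sub>1\<^sub>3)) = (0, 1)"
proof -
  let ?G = "\<Gamma>_X7" and ?L = "mutation_loops X7_vertices X7" and ?c = "loop_class X7_vertices X7"
  let ?D = "derived ?G (carrier ?G)" and ?H = "integer_mod_group 5 \<times>\<times> integer_mod_group 2"
  define q where "q w = abelianization_map ?G (?c w)" for w
  interpret G: group ?G
    unfolding \<Gamma>_X7_def by (rule group_saturated_cluster_modular_group)
  interpret D: normal ?D ?G
    by (rule G.derived_self_is_normal)
  have carrier: "carrier ?G = ?c ` ?L"
    by (simp add: \<Gamma>_X7_def carrier_saturated_cluster_modular_group)
  have mult: "?c x \<otimes>\<^bsub>?G\<^esub> ?c y = ?c (x @ y)" if "x \<in> ?L" "y \<in> ?L" for x y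
    unfolding \<Gamma>_X7_def using that by (rule mult_loop_class)
  have class_eq: "?c x = ?c y \<longleftrightarrow> (x, y) \<in> loop_equiv X7_vertices X7" if "x \<in> ?L" "y \<in> ?L" for x y
    unfolding loop_class_def using eq_equiv_class_iff[OF equiv_loop_equiv that] .
  have abel_carrier: "carrier (abelianization ?G) = q ` ?L"
    by (auto simp: abelianization_def FactGroup_def RCOSETS_def carrier q_def abelianization_map_def)
  interpret A: comm_group "abelianization ?G"
    unfolding abelianization_def by (rule G.derived_quot_is_comm_group)
  interpret A: X7_character "abelianization ?G" q
  proof unfold_locales
    fix x y
    show "q x \<in> carrier (abelianization ?G)" if "x \<in> ?L"
      using that abel_carrier by blast
    show "q (x @ y) = q x \<otimes>\<^bsub>abelianization ?G\<^esub> q y" if "x \<in> ?L" "y \<in> ?L"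
      using that carrier D.rcos_sum[of "?c x" "?c y"]
      by (simp add: q_def abelianization_map_def abelianization_def FactGroup_def mult)
    show "q x = q y" if "(x, y) \<in> loop_equiv X7_vertices X7"
      using that class_eq[of x y] by (simp add: loop_equiv_def q_def)
  qed
  \<comment> \<open>The invariant depends only on the class of a loop, so any representative may be used.\<close>
  define h where "h X = invariant (SOME w. w \<in> ?L \<and> ?c w = X)" for X
  have h: "h (?c w) = invariant w" if "w \<in> ?L" for w
  proof -
    have "(SOME v. v \<in> ?L \<and> ?c v = ?c w) \<in> ?L \<and> ?c (SOME v. v \<in> ?L \<and> ?c v = ?c w) = ?c w"
      by (rule someI[of _ w]) (simp add: that)
    then show ?thesis
      unfolding h_def using class_eq that invariant_loop_equiv by blast
  qed
  have comm: "comm_group ?H"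
    by (rule group.group_comm_groupI[OF DirProd_group]) (auto simp: add.commute)
  interpret h: group_hom ?G ?H h
  proof (intro group_hom.intro group_hom_axioms.intro homI)
    show "group ?H" using comm by (simp add: comm_group_def)
    show "h X \<in> carrier ?H" if "X \<in> carrier ?G" for X
      using that h invariant_carrier unfolding carrier by fastforce
    show "h (X \<otimes>\<^bsub>?G\<^esub> Y) = h X \<otimes>\<^bsub>?H\<^esub> h Y" if "X \<in> carrier ?G" "Y \<in> carrier ?G" for X Y
      using that unfolding carrier by (auto simp: mult h invariant_append)
  qed (rule G.is_group)
  have "h ` ?D = {\<one>\<^bsub>?H\<^esub>}"
    using h.derived_img[of "carrier ?G"] comm_group.derived_eq_singleton[OF comm, of "h ` carrier ?G"]
      h.hom_closed by blast
  then have "?D \<subseteq> kernel ?G ?H h"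
    using D.subset by (auto simp: kernel_def)
  then obtain \<phi> where hom: "\<phi> \<in> hom (?G Mod ?D) ?H"
    and \<phi>: "\<And>X. X \<in> carrier ?G \<Longrightarrow> \<phi> (?D #>\<^bsub>?G\<^esub> X) = h X"
    using h.FactGroup_universal_kernel[OF D.normal_axioms] by blast
  have \<phi>_q: "\<phi> (q w) = invariant w" if "w \<in> ?L" for w
    using that \<phi> h carrier by (simp add: q_def abelianization_map_def)
  have "q x = q y" if "x \<in> ?L" "y \<in> ?L" "invariant x = invariant y" for x y
    using A.character_formula[OF that(1)] A.character_formula[OF that(2)] that(3) by simp
  then have "inj_on \<phi> (q ` ?L)"
    by (intro inj_onI) (metis \<phi>_q imageE)
  then have "inj_on \<phi> (carrier (abelianization ?G))"
    by (simp only: abel_carrier)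
  moreover have "\<phi> ` carrier (abelianization ?G) = carrier ?H"
  proof
    show "\<phi> ` carrier (abelianization ?G) \<subseteq> carrier ?H"
      unfolding abel_carrier by (intro image_subsetI) (metis \<phi>_q imageE invariant_carrier)
    show "carrier ?H \<subseteq> \<phi> ` carrier (abelianization ?G)"
    proof
      fix z assume "z \<in> carrier ?H"
      then obtain w where "w \<in> ?L" "invariant w = z"
        using invariant_surjective by blast
      then show "z \<in> \<phi> ` carrier (abelianization ?G)"
        unfolding abel_carrier using \<phi>_q by force
    qed
  qed
  ultimately have "\<phi> \<in> iso (abelianization ?G) ?H"
    using hom by (simp add: iso_def bij_betw_def abelianization_def)
  then show ?thesis
    using \<phi>_q[OF \<psi>\<^sub>1_in_mutation_loops] \<phi>_q[OF \<sigma>\<^sub>1\<^sub>3_in_mutation_loops] invariant_generators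
    by (auto simp: q_def)
qed

end
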